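(* Consider the planar piecewise linear system $$\dot{\mathbf x}=\begin{cases}A_L\mathbf x+\mathbf b_L, & x_1\le 0,\\ A_R\mathbf x+\mathbf b_R, & x_1\ge 0,\end{cases}\qquad \mathbf x=(x_1,x_2)\in\mathbb R^2,$$ with $A_{L,R}=(a_{ij}^{L,R})$ real $2\times2$ matrices, $\mathbf b_{L,R}=(b_1^{L,R},b_2^{L,R})\in\mathbb R^2$ and $a_{12}^La_{12}^R>0$. Let $T_L,T_R$ and $D_L,D_R$ be the traces and determinants of $A_L,A_R$, and put $$a_L=a_{12}^Lb_2^L-a_{22}^Lb_1^L,\quad a_R=\frac{a_{12}^L}{a_{12}^R}(a_{12}^Rb_2^R-a_{22}^Rb_1^R),\quad b^*=\frac{a_{12}^Lb_1^R}{a_{12}^R}-b_1^L,$$ $$\Delta_b=\big(D_R(a_L^2-a_LbT_L+b^2D_L)+a_R^2D_L+a_RbD_LT_R\big)^2-4a_L^2a_R^2D_LD_R .$$ Assume that $T_L^2-4D_L<0$ and $T_R^2-4D_R<0$, and that at least one of the following holds: (a) $\Delta_{b^*}<0$; or (b) $\Delta_{b^*}=0$, $\ b^*=\dfrac{a_LD_RT_L-a_RD_LT_R}{2D_LD_R}$, and $a_La_R<0$. Then the system has no more than one (crossing) limit cycle.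
   Context: Limit cycles: solutions are understood in Filippov's sense; a point of $\Sigma=\{x_1=0\}$ is a crossing point if the first components of the two linear fields there have strictly positive product. A crossing periodic orbit is a closed orbit meeting both sides of $\Sigma$ and meeting $\Sigma$ only at crossing points; a (crossing) limit cycle is a crossing periodic orbit isolated in the set of all crossing periodic orbits. *)

theory Defs
  imports "HOL-Analysis.Analysis"
begin

definition absolutely_continuous_on :: "real set \<Rightarrow> (real \<Rightarrow> 'a::real_normed_vector) \<Rightarrow> bool" where
  "absolutely_continuous_on S x \<longleftrightarrow>
     (\<forall>\<epsilon>>0. \<exists>\<delta>>0. \<forall>(n::nat) (a::nat \<Rightarrow> real) (b::nat \<Rightarrow> real).
        (\<forall>i<n. a i \<le> b i \<and> {a i..b i} \<subseteq> S) \<and>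
        disjoint_family_on (\<lambda>i. {a i<..<b i}) {..<n} \<and>
        (\<Sum>i<n. b i - a i) < \<delta>
        \<longrightarrow> (\<Sum>i<n. norm (x (b i) - x (a i))) < \<epsilon>)"

text \<open>Below, \<open>fL\<close> and \<open>fR\<close> are the fields to the left and to the right of the
  switching line, the set of points \<open>p\<close> with \<open>p $ 1 = 0\<close>. On the line, Filippov's convention
  allows every convex combination of the two field values.\<close>

definition filippov_set :: "(real^2 \<Rightarrow> real^2) \<Rightarrow> (real^2 \<Rightarrow> real^2) \<Rightarrow> real^2 \<Rightarrow> (real^2) set" where
  "filippov_set fL fR p =
     (if p $ 1 < 0 then {fL p}
      else if p $ 1 > 0 then {fR p}
      else convex hull {fL p, fR p})"

definition filippov_solution ::
    "(real^2 \<Rightarrow> real^2) \<Rightarrow> (real^2 \<Rightarrow> real^2) \<Rightarrow> (real \<Rightarrow> real^2) \<Rightarrow> bool" where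
  "filippov_solution fL fR x \<longleftrightarrow>
     (\<forall>s t. absolutely_continuous_on {s..t} x) \<and>
     (AE t in lborel. \<exists>v\<in>filippov_set fL fR (x t). (x has_vector_derivative v) (at t))"

definition crossing_point :: "(real^2 \<Rightarrow> real^2) \<Rightarrow> (real^2 \<Rightarrow> real^2) \<Rightarrow> real^2 \<Rightarrow> bool" where
  "crossing_point fL fR p \<longleftrightarrow> p $ 1 = 0 \<and> fL p $ 1 * fR p $ 1 > 0"

text \<open>An orbit is a set of points. No injectivity of \<open>x\<close> over a period is required: solutions
  are unique away from the line and at crossing points, so the orbits below are automatically
  simple closed curves.\<close>

definition crossing_periodic_orbit ::
    "(real^2 \<Rightarrow> real^2) \<Rightarrow> (real^2 \<Rightarrow> real^2) \<Rightarrow> (real^2) set \<Rightarrow> bool" where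
  "crossing_periodic_orbit fL fR \<Gamma> \<longleftrightarrow>
     (\<exists>x T. filippov_solution fL fR x \<and> T > 0 \<and> (\<forall>t. x (t + T) = x t) \<and> \<Gamma> = range x) \<and>
     (\<exists>p\<in>\<Gamma>. p $ 1 < 0) \<and> (\<exists>p\<in>\<Gamma>. p $ 1 > 0) \<and>
     (\<forall>p\<in>\<Gamma>. p $ 1 = 0 \<longrightarrow> crossing_point fL fR p)"

definition crossing_limit_cycle ::
    "(real^2 \<Rightarrow> real^2) \<Rightarrow> (real^2 \<Rightarrow> real^2) \<Rightarrow> (real^2) set \<Rightarrow> bool" where
  "crossing_limit_cycle fL fR \<Gamma> \<longleftrightarrow>
     crossing_periodic_orbit fL fR \<Gamma> \<and>
     (\<exists>U. open U \<and> \<Gamma> \<subseteq> U \<and>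
        (\<forall>\<Gamma>'. crossing_periodic_orbit fL fR \<Gamma>' \<and> \<Gamma>' \<subseteq> U \<longrightarrow> \<Gamma>' = \<Gamma>))"

definition Delta :: "real \<Rightarrow> real \<Rightarrow> real \<Rightarrow> real \<Rightarrow> real \<Rightarrow> real \<Rightarrow> real \<Rightarrow> real" where
  "Delta TL TR DL DR aL aR b =
     (DR * (aL^2 - aL * b * TL + b^2 * DL) + aR^2 * DL + aR * b * DL * TR)^2
       - 4 * aL^2 * aR^2 * DL * DR"

end

theory Submission
  imports Defs
begin

text \<open>
  Both fields have a focus, and everything happens on the line \<open>x\<^sub>1 = 0\<close>. A point of the line is
  labelled by \<open>v\<close>, the first component of the left field; the first component of the right field
  is there a positive multiple of \<open>v + b\<close>. Let an arc in the left half-plane start with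
  \<open>v\<^sub>0 < 0\<close> and end with \<open>v\<^sub>1 > 0\<close>. The logarithmic spirals of a linear focus give
  \<open>\<Phi>\<^sub>L v\<^sub>1 - \<Phi>\<^sub>L v\<^sub>0 = K\<^sub>L\<close> (\<open>focus_arc_integral\<close>), where \<open>K\<^sub>L\<close> depends only on the system and
  \<open>\<Phi>\<^sub>L\<close> is a primitive of \<open>v / (v\<^sup>2 + (a T / D) v + a\<^sup>2 / D)\<close>. An arc in the right half-plane
  from \<open>v\<^sub>1\<close> back to \<open>v\<^sub>2\<close> satisfies \<open>\<Phi>\<^sub>R (v\<^sub>2 + b) - \<Phi>\<^sub>R (v\<^sub>1 + b) = K\<^sub>R\<close> in the same way.

  Each primitive decreases on negative and increases on positive arguments, so both half-return
  maps are decreasing. Hence the leftward crossing with the least \<open>v\<close> on a crossing periodic orbit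
  returns to itself after one left and one right arc (\<open>crossing_motion_fixed_loop\<close>). If two
  periodic orbits had loops \<open>(p, q)\<close> and \<open>(p', q')\<close> with \<open>p < p'\<close>, the loops would be nested,
  \<open>p < p' < 0 < q' < q\<close>. The function \<open>\<Psi> v = \<Phi>\<^sub>L v - \<Phi>\<^sub>R (v + b)\<close> has the same increment
  \<open>K\<^sub>L + K\<^sub>R\<close> over both, so its increments over \<open>[p, p']\<close> and \<open>[q', q]\<close> would add up to \<open>0\<close>. But
  for \<open>b \<noteq> 0\<close> the hypothesis \<open>\<Delta> \<le> 0\<close> bounds the numerator of \<open>b \<Psi>'\<close> by minus a square
  (\<open>slope_difference_numerator\<close>), so \<open>b \<Psi>\<close> strictly decreases wherever \<open>v\<close> and \<open>v + b\<close> have the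
  same sign, in particular over both intervals. Hence any two crossing periodic orbits share a
  point, and uniqueness of solutions makes them equal.

  For \<open>b = 0\<close> the quantity \<open>\<Delta>\<close> is a square, so only the second alternative can hold; it makes the
  right field the mirror image of the left one with time reversed. Every left arc then closes up
  with its mirror image. A left arc is determined by its duration, and nearby durations give nearby
  arcs, so no crossing periodic orbit is isolated and there is no limit cycle at all
  (\<open>no_crossing_limit_cycle\<close>).

  Filippov solutions are only absolutely continuous. A bound on the increments of absolutely
  continuous functions with a bound on the derivative almost everywhere
  (\<open>absolutely_continuous_on_increment_le\<close>) shows that they solve the linear equations classically
  on either side and cross the line transversally at crossing points.
\<close>

section \<open>Absolutely continuous functions\<close>

text \<open>The mean value inequality needs only a bound on the derivative almost everywhere. Points of the
  exceptional null set are put into an open set of small measure. A tagged division fine enough for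
  the derivative bound at the good points and for that open set at the bad ones splits the increment
  of \<open>g\<close>: the good pieces obey the bound, and the bad pieces have small total length, so absolute
  continuity makes their contribution small.\<close>
lemma absolutely_continuous_on_increment_le:
  fixes g :: "real \<Rightarrow> real"
  assumes ac: "absolutely_continuous_on {a..b} g" and ab: "a \<le> b"
    and der: "AE t in lborel. t \<in> {a<..<b} \<longrightarrow> (\<exists>v\<le>c. (g has_real_derivative v) (at t))"
  shows "g b - g a \<le> c * (b - a)"
proof (rule field_le_epsilon)
  fix e :: real assume "e > 0"
  define e1 where "e1 = e / (2 * (b - a + 1))"
  have e1: "e1 > 0" and e1b: "e1 * (b - a) \<le> e / 2"
    using \<open>e > 0\<close> ab by (auto simp: e1_def field_simps)
  obtain \<delta> where \<delta>: "\<delta> > 0" and ac\<delta>: "\<And>n (u::nat \<Rightarrow> real) (v::nat \<Rightarrow> real).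
        (\<forall>i<n. u i \<le> v i \<and> {u i..v i} \<subseteq> {a..b}) \<Longrightarrow>
        disjoint_family_on (\<lambda>i. {u i<..<v i}) {..<n} \<Longrightarrow>
        (\<Sum>i<n. v i - u i) < \<delta> \<Longrightarrow> (\<Sum>i<n. norm (g (v i) - g (u i))) < e / 4"
  proof -
    have "e / 4 > 0" using \<open>e > 0\<close> by simp
    from ac[unfolded absolutely_continuous_on_def, rule_format, OF this]
    show ?thesis using that by meson
  qed
  \<comment> \<open>The second bound on \<open>\<delta>'\<close> controls the error of applying the slope \<open>c\<close> to the good pieces only.\<close>
  obtain \<delta>' where \<delta>': "\<delta>' > 0" "\<delta>' \<le> \<delta>" "\<bar>c\<bar> * \<delta>' \<le> e / 4"
  proof
    show "min \<delta> (e / 4 / (\<bar>c\<bar> + 1)) > 0" using \<delta> \<open>e > 0\<close> by simp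
    show "min \<delta> (e / 4 / (\<bar>c\<bar> + 1)) \<le> \<delta>" by simp
    have "\<bar>c\<bar> * min \<delta> (e / 4 / (\<bar>c\<bar> + 1)) \<le> \<bar>c\<bar> * (e / 4 / (\<bar>c\<bar> + 1))"
      by (intro mult_left_mono) auto
    also have "\<dots> \<le> e / 4" using \<open>e > 0\<close> by (simp add: field_simps)
    finally show "\<bar>c\<bar> * min \<delta> (e / 4 / (\<bar>c\<bar> + 1)) \<le> e / 4" .
  qed
  obtain N0 where N0: "{t \<in> space lborel. \<not> (t \<in> {a<..<b} \<longrightarrow> (\<exists>v\<le>c. (g has_real_derivative v) (at t)))} \<subseteq> N0"
      "emeasure lborel N0 = 0" "N0 \<in> sets lborel"
    using der by (rule AE_E)
  define N where "N = N0 \<union> {a, b}"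
  have "N \<in> null_sets lborel"
    unfolding N_def using N0 finite_imp_null_set_lborel[of "{a, b}"]
    by (intro null_sets.Un) (simp_all add: null_sets_def)
  then have "N \<in> null_sets lebesgue" by (rule null_sets_completionI)
  then have Nm: "N \<in> sets lebesgue" and Nz: "emeasure lebesgue N = 0"
    by auto
  obtain W where W: "open W" "N \<subseteq> W" "W - N \<in> lmeasurable" "emeasure lebesgue (W - N) < ennreal \<delta>'"
    using sets_lebesgue_outer_open[OF Nm \<open>\<delta>' > 0\<close>] by metis
  have Wm: "W \<in> sets lebesgue" using W(1) by auto
  have "emeasure lebesgue W = emeasure lebesgue (W - N)"
    using \<open>N \<in> null_sets lebesgue\<close> Wm by (simp add: emeasure_Diff_null_set)
  then have We: "emeasure lebesgue W < ennreal \<delta>'" using W(4) by simp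
  then have Wl: "W \<in> lmeasurable" using Wm by (auto simp: fmeasurable_def intro: less_trans)
  have Wlt: "measure lebesgue W < \<delta>'"
    using We \<open>\<delta>' > 0\<close> Wl by (simp add: emeasure_eq_measure2 ennreal_less_iff)
  \<comment> \<open>The gauge: small balls inside \<open>W\<close> at bad points, balls on which the derivative
    controls increments at good ones.\<close>
  have "\<exists>d>0. (t \<in> N \<longrightarrow> ball t d \<subseteq> W) \<and>
     (t \<notin> N \<longrightarrow> t \<in> {a..b} \<longrightarrow> (\<forall>u v. u \<le> t \<longrightarrow> t \<le> v \<longrightarrow> u \<in> ball t d \<longrightarrow> v \<in> ball t d \<longrightarrow>
        g v - g u \<le> (c + e1) * (v - u)))" for t
  proof (cases "t \<in> N")
    case True
    then obtain d where "d > 0" "ball t d \<subseteq> W" using W by (meson in_mono openE)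
    then show ?thesis using True by blast
  next
    case False
    show ?thesis
    proof (cases "t \<in> {a..b}")
      case True
      have "t \<in> {a<..<b}" "t \<notin> N0" using False True by (auto simp: N_def)
      then obtain w where w: "w \<le> c" "(g has_real_derivative w) (at t)"
        using N0(1) by auto
      from w(2) have "(g has_derivative (\<lambda>h. h * w)) (at t)"
        by (simp add: has_field_derivative_def mult_commute_abs)
      then obtain d where d: "d > 0" and dd: "\<And>y. norm (y - t) < d \<Longrightarrow> norm (g y - g t - (y - t) * w) \<le> e1 * norm (y - t)"
        using e1 unfolding has_derivative_at_alt by blast
      have "g v - g u \<le> (c + e1) * (v - u)"
        if "u \<le> t" "t \<le> v" "u \<in> ball t d" "v \<in> ball t d" for u v
      proof -
        have 1: "\<bar>g v - g t - (v - t) * w\<bar> \<le> e1 * \<bar>v - t\<bar>" "\<bar>g u - g t - (u - t) * w\<bar> \<le> e1 * \<bar>u - t\<bar>"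
          using dd[of v] dd[of u] that by (auto simp: dist_real_def abs_minus_commute)
        have "g v - g u \<le> (v - t) * w + e1 * (v - t) - (u - t) * w + e1 * (t - u)"
          using 1 that(1,2) by (simp add: abs_le_iff)
        also have "\<dots> = (w + e1) * (v - u)" by (simp add: algebra_simps)
        also have "\<dots> \<le> (c + e1) * (v - u)" using w(1) that by (intro mult_right_mono) auto
        finally show ?thesis .
      qed
      then show ?thesis using d False by blast
    qed (auto intro: exI[of _ 1] simp: False)
  qed
  then obtain d where d: "\<And>t. d t > 0" "\<And>t. t \<in> N \<Longrightarrow> ball t (d t) \<subseteq> W"
    and dg: "\<And>t u v. t \<notin> N \<Longrightarrow> t \<in> {a..b} \<Longrightarrow> u \<le> t \<Longrightarrow> t \<le> v \<Longrightarrow> u \<in> ball t (d t) \<Longrightarrow> v \<in> ball t (d t)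
        \<Longrightarrow> g v - g u \<le> (c + e1) * (v - u)"
    by metis
  have "gauge (\<lambda>t. ball t (d t))" using d(1) by (auto simp: gauge_def)
  then obtain p where p: "p tagged_division_of {a..b}" and fine: "(\<lambda>t. ball t (d t)) fine p"
    by (rule fine_division_exists_real)
  have finp: "finite p" using p by (auto simp: tagged_division_of_def tagged_partial_division_of_def)
  have K: "K = {Inf K..Sup K} \<and> Inf K \<le> x \<and> x \<le> Sup K \<and> K \<subseteq> {a..b} \<and> x \<in> {a..b} \<and> Inf K \<in> ball x (d x) \<and> Sup K \<in> ball x (d x) \<and> K \<subseteq> ball x (d x)"
    if "(x, K) \<in> p" for x K
  proof -
    obtain u v where uv: "K = {u..v}" "x \<in> K" "K \<subseteq> {a..b}"
      using tagged_division_ofD(2,3,4)[OF p \<open>(x, K) \<in> p\<close>] by auto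
    then have "u \<le> v" by auto
    moreover have "K \<subseteq> ball x (d x)" using fine that by (auto simp: fine_def)
    moreover have "u \<in> K" "v \<in> K" using uv(1) \<open>u \<le> v\<close> by auto
    ultimately have "u \<in> ball x (d x)" "v \<in> ball x (d x)" by blast+
    moreover have "Inf K = u" "Sup K = v" using uv(1) \<open>u \<le> v\<close> by auto
    ultimately show ?thesis using uv \<open>K \<subseteq> ball x (d x)\<close> by auto
  qed
  \<comment> \<open>The tags in the exceptional set; \<open>I\<close> and \<open>S\<close> are the ends of a piece.\<close>
  define pN where "pN = {(x, K) \<in> p. x \<in> N}"
  have pNp: "pN \<subseteq> p" and finN: "finite pN" using finp by (auto simp: pN_def intro: finite_subset)
  define I where "I = (\<lambda>xK::real \<times> real set. Inf (snd xK))"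
  define S where "S = (\<lambda>xK::real \<times> real set. Sup (snd xK))"
  have disj: "{I k<..<S k} \<inter> {I l<..<S l} = {}" if "k \<in> p" "l \<in> p" "k \<noteq> l" for k l
  proof -
    obtain x K y L where kl: "k = (x, K)" "l = (y, L)" by (meson surj_pair)
    have "interior K \<inter> interior L = {}"
      using p that kl unfolding tagged_division_of_def tagged_partial_division_of_def by blast
    moreover have "interior K = {Inf K<..<Sup K}" "interior L = {Inf L<..<Sup L}"
      using K[of x K] K[of y L] that kl by (metis interior_atLeastAtMost_real)+
    ultimately show ?thesis by (simp add: kl I_def S_def)
  qed
  have le: "I k \<le> S k" "{I k..S k} \<subseteq> {a..b}" if "k \<in> p" for k
    using K[of "fst k" "snd k"] that by (auto simp: I_def S_def)
  have len: "(\<Sum>k\<in>pN. S k - I k) < \<delta>'"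
  proof -
    have "(\<Sum>k\<in>pN. S k - I k) = (\<Sum>k\<in>pN. measure lebesgue {I k<..<S k})"
      using le pNp by (intro sum.cong refl) (auto simp: measure_completion subset_iff)
    also have "\<dots> = measure lebesgue (\<Union>k\<in>pN. {I k<..<S k})"
    proof (intro measure_finite_Union[symmetric] finN)
      show "disjoint_family_on (\<lambda>k. {I k<..<S k}) pN"
        using disj pNp unfolding disjoint_family_on_def by blast
      show "emeasure lebesgue {I k<..<S k} \<noteq> \<infinity>" for k
        using fmeasurableD2[OF lmeasurable_box, of "I k" "S k"] by (simp add: box_real)
    qed auto
    also have "\<dots> \<le> measure lebesgue W"
    proof (rule measure_mono_fmeasurable)
      show "(\<Union>k\<in>pN. {I k<..<S k}) \<subseteq> W"
      proof (clarify)
        fix x K t assume "(x, K) \<in> pN" "t \<in> {I (x, K)<..<S (x, K)}"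
        then have "t \<in> {Inf K..Sup K}" "(x, K) \<in> p" "x \<in> N" by (auto simp: I_def S_def pN_def)
        then show "t \<in> W" using K[of x K] d(2)[of x] by blast
      qed
      show "(\<Union>k\<in>pN. {I k<..<S k}) \<in> sets lebesgue"
        using finN by (intro sets.finite_UN) auto
    qed (use Wl in auto)
    also have "\<dots> < \<delta>'" using Wlt .
    finally show ?thesis .
  qed
  have sN: "(\<Sum>k\<in>pN. norm (g (S k) - g (I k))) < e / 4"
  proof -
    obtain h where h: "bij_betw h {..<card pN} pN"
      using finN bij_betw_from_nat_into_finite by blast
    have hin: "h i \<in> p" "h i \<in> pN" if "i < card pN" for i using h that pNp by (auto simp: bij_betw_def)
    have "(\<Sum>i<card pN. norm (g (S (h i)) - g (I (h i)))) < e / 4"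
    proof (rule ac\<delta>)
      show "\<forall>i<card pN. I (h i) \<le> S (h i) \<and> {I (h i)..S (h i)} \<subseteq> {a..b}"
        using le hin by blast
      show "disjoint_family_on (\<lambda>i. {I (h i)<..<S (h i)}) {..<card pN}"
        unfolding disjoint_family_on_def
      proof (intro ballI impI)
        fix i j assume "i \<in> {..<card pN}" "j \<in> {..<card pN}" "i \<noteq> j"
        then have "h i \<noteq> h j" using h by (auto simp: bij_betw_def inj_on_def)
        then show "{I (h i)<..<S (h i)} \<inter> {I (h j)<..<S (h j)} = {}"
          using disj hin \<open>i \<in> _\<close> \<open>j \<in> _\<close> by simp
      qed
      show "(\<Sum>i<card pN. S (h i) - I (h i)) < \<delta>"
        using len \<delta>'(2) sum.reindex_bij_betw[OF h, of "\<lambda>k. S k - I k"] by simp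
    qed
    then show ?thesis using sum.reindex_bij_betw[OF h, of "\<lambda>k. norm (g (S k) - g (I k))"] by simp
  qed
  have tel: "(\<Sum>k\<in>p. h (S k) - h (I k)) = h b - h a" for h :: "real \<Rightarrow> real"
    using additive_tagged_division_1[OF ab p, of h] by (simp add: I_def S_def case_prod_beta)
  have "g b - g a = (\<Sum>k\<in>p. g (S k) - g (I k))" using tel by simp
  also have "\<dots> = (\<Sum>k\<in>pN. g (S k) - g (I k)) + (\<Sum>k\<in>p - pN. g (S k) - g (I k))"
    using sum.subset_diff[OF pNp finp] by (simp add: add.commute)
  also have "(\<Sum>k\<in>pN. g (S k) - g (I k)) \<le> e / 4"
    using sum_mono[of pN "\<lambda>k. g (S k) - g (I k)" "\<lambda>k. norm (g (S k) - g (I k))"] sN by fastforce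
  also have "(\<Sum>k\<in>p - pN. g (S k) - g (I k)) \<le> (\<Sum>k\<in>p - pN. (c + e1) * (S k - I k))"
  proof (rule sum_mono)
    fix k assume k: "k \<in> p - pN"
    obtain x L where kk: "k = (x, L)" by (meson surj_pair)
    then have "x \<notin> N" "(x, L) \<in> p" using k by (auto simp: pN_def)
    then show "g (S k) - g (I k) \<le> (c + e1) * (S k - I k)"
      using dg[of x "Inf L" "Sup L"] K[of x L] kk by (simp add: I_def S_def)
  qed
  also have "\<dots> = (c + e1) * ((b - a) - (\<Sum>k\<in>pN. S k - I k))"
  proof -
    have "(\<Sum>k\<in>p - pN. S k - I k) = (b - a) - (\<Sum>k\<in>pN. S k - I k)"
      using sum.subset_diff[OF pNp finp, of "\<lambda>k. S k - I k"] tel[of "\<lambda>x. x"] by simp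
    then show ?thesis by (simp only: sum_distrib_left[symmetric])
  qed
  also have "\<dots> \<le> c * (b - a) + e1 * (b - a) + \<bar>c\<bar> * \<delta>'"
  proof -
    have 0: "(\<Sum>k\<in>pN. S k - I k) \<ge> 0" using le pNp by (intro sum_nonneg) auto
    have "- (c * (\<Sum>k\<in>pN. S k - I k)) \<le> \<bar>c\<bar> * (\<Sum>k\<in>pN. S k - I k)"
      using 0 by (metis abs_ge_minus_self mult_minus_left mult_right_mono)
    also have "\<dots> \<le> \<bar>c\<bar> * \<delta>'" using len by (intro mult_left_mono) auto
    finally have 1: "- (c * (\<Sum>k\<in>pN. S k - I k)) \<le> \<bar>c\<bar> * \<delta>'" .
    have 2: "0 \<le> e1 * (\<Sum>k\<in>pN. S k - I k)" using 0 e1 by simp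
    have "(c + e1) * ((b - a) - (\<Sum>k\<in>pN. S k - I k)) =
       c * (b - a) + e1 * (b - a) - c * (\<Sum>k\<in>pN. S k - I k) - e1 * (\<Sum>k\<in>pN. S k - I k)"
      by (simp only: distrib_right right_diff_distrib)
    then show ?thesis using 1 2 by linarith
  qed
  also have "\<dots> \<le> c * (b - a) + e / 2 + e / 4" using e1b \<delta>'(3) by simp
  finally show "g b - g a \<le> c * (b - a) + e" by simp
qed

section \<open>Filippov solutions off the line and at crossing points\<close>

lemma absolutely_continuous_on_bounded_linear:
  assumes ac: "absolutely_continuous_on S x" and h: "bounded_linear h"
  shows "absolutely_continuous_on S (\<lambda>t. h (x t))"
  unfolding absolutely_continuous_on_def
proof (intro allI impI)
  fix e :: real assume "e > 0"
  obtain B where B: "B > 0" "\<And>y. norm (h y) \<le> norm y * B"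
    using bounded_linear.pos_bounded[OF h] by auto
  have "e / B > 0" using \<open>e > 0\<close> B by simp
  then obtain d where d: "d > 0" "\<And>n a b. (\<forall>i<(n::nat). a i \<le> b i \<and> {a i..b i} \<subseteq> S) \<and>
        disjoint_family_on (\<lambda>i. {a i<..<b i}) {..<n} \<and> (\<Sum>i<n. b i - a i) < d
        \<Longrightarrow> (\<Sum>i<n. norm (x (b i) - x (a i))) < e / B"
    using ac[unfolded absolutely_continuous_on_def] by meson
  have "(\<Sum>i<n. norm (h (x (b i)) - h (x (a i)))) < e"
    if "(\<forall>i<(n::nat). a i \<le> b i \<and> {a i..b i} \<subseteq> S) \<and>
        disjoint_family_on (\<lambda>i. {a i<..<b i}) {..<n} \<and> (\<Sum>i<n. b i - a i) < d" for n a b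
  proof -
    have "(\<Sum>i<n. norm (h (x (b i)) - h (x (a i)))) \<le> (\<Sum>i<n. norm (x (b i) - x (a i)) * B)"
      by (intro sum_mono) (metis B(2) bounded_linear.linear h linear_diff)
    also have "\<dots> = (\<Sum>i<n. norm (x (b i) - x (a i))) * B" by (simp add: sum_distrib_right)
    also have "\<dots> < e / B * B" using d(2)[OF that] B by (intro mult_strict_right_mono)
    finally show ?thesis using B by simp
  qed
  then show "\<exists>\<delta>>0. \<forall>n a b. (\<forall>i<(n::nat). a i \<le> b i \<and> {a i..b i} \<subseteq> S) \<and>
        disjoint_family_on (\<lambda>i. {a i<..<b i}) {..<n} \<and> (\<Sum>i<n. b i - a i) < \<delta> \<longrightarrow>
        (\<Sum>i<n. norm (h (x (b i)) - h (x (a i)))) < e"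
    using d(1) by blast
qed

lemma filippov_solution_increment_le:
  assumes sol: "filippov_solution fL fR x" and h: "bounded_linear h" and st: "s \<le> t"
    and le: "\<And>r w. r \<in> {s<..<t} \<Longrightarrow> w \<in> filippov_set fL fR (x r) \<Longrightarrow> h w \<le> (c::real)"
  shows "h (x t) - h (x s) \<le> c * (t - s)"
proof (rule absolutely_continuous_on_increment_le[OF _ st])
  show "absolutely_continuous_on {s..t} (\<lambda>r. h (x r))"
    using sol by (intro absolutely_continuous_on_bounded_linear[OF _ h]) (auto simp: filippov_solution_def)
  have "AE r in lborel. \<exists>v\<in>filippov_set fL fR (x r). (x has_vector_derivative v) (at r)"
    using sol by (simp add: filippov_solution_def)
  then show "AE r in lborel. r \<in> {s<..<t} \<longrightarrow> (\<exists>v\<le>c. ((\<lambda>r. h (x r)) has_real_derivative v) (at r))"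
  proof (rule AE_mp, intro AE_I2 impI)
    fix r assume "\<exists>v\<in>filippov_set fL fR (x r). (x has_vector_derivative v) (at r)" and r: "r \<in> {s<..<t}"
    then obtain v where v: "v \<in> filippov_set fL fR (x r)" "(x has_vector_derivative v) (at r)" by blast
    have "((\<lambda>r. h (x r)) has_vector_derivative h v) (at r)"
      using bounded_linear.has_vector_derivative[OF h v(2)] .
    then show "\<exists>v\<le>c. ((\<lambda>r. h (x r)) has_real_derivative v) (at r)"
      using le[OF r v(1)] by (auto simp: has_real_derivative_iff_has_vector_derivative)
  qed
qed

lemma filippov_solution_continuous:
  assumes "filippov_solution fL fR x"
  shows "continuous_on S x"
proof -
  have "isCont x t" for t
    unfolding continuous_at_eps_delta
  proof (intro allI impI)
    fix e :: real assume "e > 0"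
    have "absolutely_continuous_on {t - 1..t + 1} x" using assms by (simp add: filippov_solution_def)
    then obtain d where d: "d > 0" "\<And>n a b. (\<forall>i<(n::nat). a i \<le> b i \<and> {a i..b i} \<subseteq> {t - 1..t + 1}) \<and>
        disjoint_family_on (\<lambda>i. {a i<..<b i}) {..<n} \<and> (\<Sum>i<n. b i - a i) < d
        \<Longrightarrow> (\<Sum>i<n. norm (x (b i) - x (a i))) < e"
      using \<open>e > 0\<close> unfolding absolutely_continuous_on_def by meson
    have "dist (x u) (x t) < e" if "dist u t < min d 1" for u
      using d(2)[of 1 "\<lambda>_. min u t" "\<lambda>_. max u t"] that
      by (cases "u \<le> t") (auto simp: disjoint_family_on_def dist_norm dist_real_def norm_minus_commute min_def max_def split: if_splits)
    then show "\<exists>d>0. \<forall>u. dist u t < d \<longrightarrow> dist (x u) (x t) < e"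
      using d(1) by (intro exI[of _ "min d 1"]) auto
  qed
  then show ?thesis by (simp add: continuous_at_imp_continuous_on)
qed

lemma bounded_linear_scaled_nth: "bounded_linear (\<lambda>w::real^'n. e * w $ i)"
  using bounded_linear_const_mult[OF bounded_linear_vec_nth] .

text \<open>The difference quotients of each coordinate lie between bounds on the field near \<open>x r\<close>, and the
  field is continuous; so the derivative exists at every time, one-sided at the ends of the arc.\<close>
lemma filippov_solution_smooth_arc:
  assumes sol: "filippov_solution fL fR x" and f: "continuous_on UNIV f"
    and one: "\<And>r. r \<in> {s<..<t} \<Longrightarrow> filippov_set fL fR (x r) = {f (x r)}"
    and r: "r \<in> {s..t}"
  shows "(x has_vector_derivative f (x r)) (at r within {s..t})"
  unfolding has_vector_derivative_def has_derivative_within_alt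
proof (intro conjI allI impI)
  show "bounded_linear (\<lambda>k. k *\<^sub>R f (x r))" by (rule bounded_linear_scaleR_left)
  fix e :: real assume "e > 0"
  have "isCont (\<lambda>y. f (x y)) r"
    using f filippov_solution_continuous[OF sol, of UNIV]
    by (metis UNIV_I continuous_on_compose2 continuous_on_eq_continuous_at open_UNIV subset_UNIV)
  then obtain d where d: "d > 0" "\<And>y. dist y r < d \<Longrightarrow> dist (f (x y)) (f (x r)) < e / 2"
    using \<open>e > 0\<close> unfolding continuous_at_eps_delta by (meson half_gt_zero)
  \<comment> \<open>The sign \<open>g\<close> yields upper and lower bounds at once.\<close>
  have near: "g * f (x y) $ i \<le> g * f (x r) $ i + e / 2" if "dist y r < d" "g \<in> {1, -1}" for y i and g :: real
  proof -
    have "\<bar>(f (x y) - f (x r)) $ i\<bar> < e / 2"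
      using d(2)[OF that(1)] component_le_norm_cart[of "f (x y) - f (x r)" i] by (simp add: dist_norm)
    then have "\<bar>f (x y) $ i - f (x r) $ i\<bar> < e / 2" by simp
    then have "f (x y) $ i < f (x r) $ i + e / 2" "- f (x y) $ i < - f (x r) $ i + e / 2"
      by (simp_all only: abs_less_iff) linarith+
    then show ?thesis using that(2) by auto
  qed
  have inc: "g * (x v - x u) $ i \<le> (g * f (x r) $ i + e / 2) * (v - u)"
    if "u \<le> v" "s \<le> u" "v \<le> t" "u \<in> ball r d" "v \<in> ball r d" "g \<in> {1, -1}" for u v i and g :: real
  proof -
    have "g * x v $ i - g * x u $ i \<le> (g * f (x r) $ i + e / 2) * (v - u)"
    proof (rule filippov_solution_increment_le[OF sol bounded_linear_scaled_nth \<open>u \<le> v\<close>])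
      fix y w assume y: "y \<in> {u<..<v}" and w: "w \<in> filippov_set fL fR (x y)"
      have "w = f (x y)" using one[of y] y w that by auto
      moreover have "dist y r < d" using y that by (auto simp: dist_real_def)
      ultimately show "g * w $ i \<le> g * f (x r) $ i + e / 2" using near that by blast
    qed
    then show ?thesis by (simp add: algebra_simps)
  qed
  have "norm (x y - x r - (y - r) *\<^sub>R f (x r)) \<le> e * norm (y - r)"
    if y: "y \<in> {s..t}" "norm (y - r) < d" for y
  proof -
    have c: "\<bar>(x y - x r - (y - r) *\<^sub>R f (x r)) $ i\<bar> \<le> e / 2 * \<bar>y - r\<bar>" for i
    proof -
      have eq: "(g * F + k) * l = g * (l * F) + k * l" for g F k l :: real
        by (simp add: algebra_simps)
      show ?thesis
      proof (cases "r \<le> y")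
        case True
        have inc': "g * (x y - x r) $ i \<le> g * ((y - r) * f (x r) $ i) + e / 2 * (y - r)"
          if "g \<in> {1, -1}" for g :: real
          unfolding eq[symmetric] using inc[of r y g i] True y r d(1) that by (auto simp: dist_real_def)
        have "\<bar>y - r\<bar> = y - r" using True by simp
        then show ?thesis using inc'[of 1] inc'[of "-1"] by (intro abs_leI) (simp_all add: left_diff_distrib)
      next
        case False
        have inc': "g * (x r - x y) $ i \<le> g * ((r - y) * f (x r) $ i) + e / 2 * (r - y)"
          if "g \<in> {1, -1}" for g :: real
          unfolding eq[symmetric] using inc[of y r g i] False y r d(1) that by (auto simp: dist_real_def)
        have "\<bar>y - r\<bar> = r - y" using False by simp
        then show ?thesis using inc'[of 1] inc'[of "-1"] by (intro abs_leI) (simp_all add: left_diff_distrib)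
      qed
    qed
    have "norm (x y - x r - (y - r) *\<^sub>R f (x r)) \<le> (\<Sum>i\<in>UNIV. \<bar>(x y - x r - (y - r) *\<^sub>R f (x r)) $ i\<bar>)"
      by (rule norm_le_l1_cart)
    also have "\<dots> \<le> (\<Sum>i\<in>(UNIV::2 set). e / 2 * \<bar>y - r\<bar>)" by (rule sum_mono) (rule c)
    finally show ?thesis by simp
  qed
  then show "\<exists>d>0. \<forall>y\<in>{s..t}. norm (y - r) < d \<longrightarrow> norm (x y - x r - (y - r) *\<^sub>R f (x r)) \<le> e * norm (y - r)"
    using d(1) by blast
qed

lemma filippov_set_subset_hull: "filippov_set fL fR p \<subseteq> convex hull {fL p, fR p}"
  unfolding filippov_set_def by (auto intro: hull_inc)

text \<open>Near a crossing point both field values, hence all their convex combinations, have first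
  component of one sign and bounded away from \<open>0\<close>.\<close>
lemma filippov_solution_crosses:
  assumes sol: "filippov_solution fL fR x"
    and cont: "continuous_on UNIV fL" "continuous_on UNIV fR"
    and zero: "x t0 $ 1 = 0" and pos: "e * fL (x t0) $ 1 > 0" "e * fR (x t0) $ 1 > 0"
  obtains d where "d > 0" "\<And>t. t \<in> {t0<..<t0 + d} \<Longrightarrow> e * x t $ 1 > 0"
    "\<And>t. t \<in> {t0 - d<..<t0} \<Longrightarrow> e * x t $ 1 < 0"
proof -
  obtain c where c: "c > 0" "e * fL (x t0) $ 1 > c" "e * fR (x t0) $ 1 > c"
    using pos dense[of 0 "min (e * fL (x t0) $ 1) (e * fR (x t0) $ 1)"] by auto
  have ev: "\<forall>\<^sub>F t in at t0. e * f (x t) $ 1 > c" if "continuous_on UNIV f" "e * f (x t0) $ 1 > c" for f :: "real^2 \<Rightarrow> real^2"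
  proof -
    have "continuous_on UNIV (\<lambda>t. e * f (x t) $ 1)"
      by (intro continuous_intros continuous_on_compose2[OF that(1) filippov_solution_continuous[OF sol]]) auto
    then have "isCont (\<lambda>t. e * f (x t) $ 1) t0" by (simp add: continuous_on_eq_continuous_at)
    then show ?thesis using that(2) by (metis isContD order_tendstoD(1))
  qed
  have "\<forall>\<^sub>F t in at t0. e * fL (x t) $ 1 > c \<and> e * fR (x t) $ 1 > c"
    using ev[OF cont(1) c(2)] ev[OF cont(2) c(3)] by eventually_elim auto
  then obtain d where d: "d > 0" "\<And>t. t \<noteq> t0 \<Longrightarrow> dist t t0 < d \<Longrightarrow> e * fL (x t) $ 1 > c \<and> e * fR (x t) $ 1 > c"
    unfolding eventually_at by auto
  have inc: "-e * x v $ 1 - -e * x u $ 1 \<le> -c * (v - u)"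
    if "u \<le> v" "\<And>y. y \<in> {u<..<v} \<Longrightarrow> y \<noteq> t0 \<and> dist y t0 < d" for u v
  proof (rule filippov_solution_increment_le[OF sol bounded_linear_scaled_nth \<open>u \<le> v\<close>])
    fix y w assume y: "y \<in> {u<..<v}" and w: "w \<in> filippov_set fL fR (x y)"
    have "convex {w::real^2. -e * w $ 1 \<le> -c}"
    proof -
      have "linear (\<lambda>w::real^2. -e * w $ 1)"
        using bounded_linear_scaled_nth bounded_linear.linear by blast
      then have "convex ((\<lambda>w::real^2. -e * w $ 1) -` {..-c})" by (rule convex_linear_vimage) simp
      then show ?thesis by (simp add: vimage_def)
    qed
    moreover have "{fL (x y), fR (x y)} \<subseteq> {w. -e * w $ 1 \<le> -c}" using d(2)[of y] that(2)[OF y] by auto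
    ultimately have "convex hull {fL (x y), fR (x y)} \<subseteq> {w. -e * w $ 1 \<le> -c}" by (rule hull_minimal[rotated])
    then show "-e * w $ 1 \<le> -c" using w filippov_set_subset_hull by blast
  qed
  show ?thesis
  proof (rule that[OF d(1)])
    fix t assume "t \<in> {t0<..<t0 + d}"
    moreover from this have "0 < c * (t - t0)" using c by simp
    ultimately show "e * x t $ 1 > 0" using inc[of t0 t] zero by (auto simp: dist_real_def)
  next
    fix t assume "t \<in> {t0 - d<..<t0}"
    moreover from this have "0 < c * (t0 - t)" using c by simp
    ultimately show "e * x t $ 1 < 0" using inc[of t t0] zero by (auto simp: dist_real_def)
  qed
qed

section \<open>Linear fields with a focus\<close>

definition focus_re :: "real^2^2 \<Rightarrow> real" where
  "focus_re A = trace A / 2"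

definition focus_im :: "real^2^2 \<Rightarrow> real" where
  "focus_im A = sqrt (4 * det A - (trace A)\<^sup>2) / 2"

text \<open>Along solutions, \<open>u = x\<^sub>1\<close> satisfies \<open>u'' = T u' - D u + a\<close>; this is the constant \<open>a\<close>, and the
  focus has abscissa \<open>a / D\<close>.\<close>
definition forcing :: "real^2^2 \<Rightarrow> real^2 \<Rightarrow> real" where
  "forcing A c = A $ 1 $ 2 * c $ 2 - A $ 2 $ 2 * c $ 1"

text \<open>The complex coordinate \<open>z\<close>, centred at the focus, in which the field becomes multiplication by
  the eigenvalue \<open>\<sigma> + i \<omega>\<close>. Its real part is \<open>x\<^sub>1\<close> minus the abscissa of the focus, so the line
  \<open>x\<^sub>1 = 0\<close> stays a vertical line.\<close>
definition focus_coord :: "real^2^2 \<Rightarrow> real^2 \<Rightarrow> real^2 \<Rightarrow> complex" where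
  "focus_coord A c p =
     Complex (p $ 1 - forcing A c / det A)
       ((focus_re A * (p $ 1 - forcing A c / det A) - (A *v p + c) $ 1) / focus_im A)"

definition focus_eigenvalue :: "real^2^2 \<Rightarrow> complex" where
  "focus_eigenvalue A = Complex (focus_re A) (focus_im A)"

lemma mult_fst: "(A *v p) $ 1 = A $ 1 $ 1 * p $ 1 + A $ 1 $ 2 * p $ (2::2)" for A :: "real^2^2"
  by (simp add: matrix_vector_mult_def sum_2)

lemma field_fst: "(A *v p + c) $ 1 = A $ 1 $ 1 * p $ 1 + A $ 1 $ 2 * p $ 2 + c $ (1::2)" for A :: "real^2^2"
  by (simp add: matrix_vector_mult_def sum_2)

lemma field_snd: "(A *v p + c) $ 2 = A $ 2 $ 1 * p $ 1 + A $ 2 $ 2 * p $ 2 + c $ (2::2)" for A :: "real^2^2"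
  by (simp add: matrix_vector_mult_def sum_2)

lemma trace_2: "trace (A :: real^2^2) = A $ 1 $ 1 + A $ 2 $ 2"
  by (simp add: trace_def sum_2)

lemma continuous_on_affine_field: "continuous_on S (\<lambda>p. A *v p + c)" for A :: "real^2^2"
  by (intro continuous_intros linear_continuous_on) simp

lemma focus_im_pos: "(trace A)\<^sup>2 - 4 * det A < 0 \<Longrightarrow> focus_im A > 0"
  by (simp add: focus_im_def)

lemma det_eq_focus: "(trace A)\<^sup>2 - 4 * det A < 0 \<Longrightarrow> det A = (focus_re A)\<^sup>2 + (focus_im A)\<^sup>2"
  by (simp add: focus_im_def focus_re_def power_divide add_divide_distrib[symmetric])

lemma det_pos_of_focus: "(trace A)\<^sup>2 - 4 * det A < 0 \<Longrightarrow> det A > 0" for A :: "real^2^2"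
  by (smt (verit) zero_le_power2)

lemma focus_coord_inj:
  assumes "A $ 1 $ 2 \<noteq> 0" "(trace A)\<^sup>2 - 4 * det A < 0" "focus_coord A c p = focus_coord A c q"
  shows "p = q"
proof -
  have 1: "p $ 1 = q $ 1" and 2: "(focus_re A * (p $ 1 - forcing A c / det A) - (A *v p + c) $ 1) / focus_im A
      = (focus_re A * (q $ 1 - forcing A c / det A) - (A *v q + c) $ 1) / focus_im A"
    using assms(3) unfolding focus_coord_def complex.inject by auto
  have "(A *v p + c) $ 1 = (A *v q + c) $ 1"
    using 2 focus_im_pos[OF assms(2)] unfolding 1 by simp
  then have "p $ 2 = q $ 2" using 1 assms(1) unfolding field_fst by simp
  then show ?thesis using 1 by (simp add: vec_eq_iff forall_2)
qed

text \<open>The first component of the field is the time derivative of \<open>Re z\<close>.\<close>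
lemma focus_coord_velocity:
  assumes "(trace A)\<^sup>2 - 4 * det A < 0"
  shows "(A *v p + c) $ 1 = Re (focus_eigenvalue A * focus_coord A c p)"
  using focus_im_pos[OF assms] by (simp add: focus_coord_def focus_eigenvalue_def)

lemma focus_coord_has_derivative:
  assumes F: "(trace A)\<^sup>2 - 4 * det A < 0"
    and x: "(x has_vector_derivative A *v x t + c) (at t within S)"
  shows "((\<lambda>t. focus_coord A c (x t)) has_vector_derivative
           focus_eigenvalue A * focus_coord A c (x t)) (at t within S)"
proof -
  define m where "m = focus_im A"
  define s where "s = focus_re A"
  define D where "D = det A"
  have m: "m > 0" and Dsm: "D = s\<^sup>2 + m\<^sup>2" and Dpos: "D > 0" and Ts: "trace A = 2 * s"
    using focus_im_pos[OF F] det_eq_focus[OF F] det_pos_of_focus[OF F]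
    by (auto simp: m_def s_def D_def focus_re_def)
  have comp: "((\<lambda>t. x t $ i) has_real_derivative (A *v x t + c) $ i) (at t within S)" for i
    using bounded_linear.has_vector_derivative[OF bounded_linear_vec_nth x]
    by (simp add: has_real_derivative_iff_has_vector_derivative)
  note d1 = comp[of 1, unfolded field_fst] and d2 = comp[of 2, unfolded field_snd]
  define v where "v = (\<lambda>t. A $ 1 $ 1 * x t $ 1 + A $ 1 $ 2 * x t $ 2 + c $ 1)"
  define f where "f = forcing A c / D"
  have fD: "f * D = A $ 1 $ 2 * c $ 2 - A $ 2 $ 2 * c $ 1" using Dpos by (simp add: f_def forcing_def)
  have Ddef: "D = A $ 1 $ 1 * A $ 2 $ 2 - A $ 1 $ 2 * A $ 2 $ 1" by (simp add: D_def det_2)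
  \<comment> \<open>The second-order equation for the first coordinate.\<close>
  have dv: "(v has_real_derivative 2 * s * v t - D * (x t $ 1 - f)) (at t within S)"
  proof -
    have "(v has_real_derivative A $ 1 $ 1 * (A $ 1 $ 1 * x t $ 1 + A $ 1 $ 2 * x t $ 2 + c $ 1)
        + A $ 1 $ 2 * (A $ 2 $ 1 * x t $ 1 + A $ 2 $ 2 * x t $ 2 + c $ 2)) (at t within S)"
      unfolding v_def by (auto intro!: derivative_eq_intros d1 d2)
    also have "A $ 1 $ 1 * (A $ 1 $ 1 * x t $ 1 + A $ 1 $ 2 * x t $ 2 + c $ 1)
        + A $ 1 $ 2 * (A $ 2 $ 1 * x t $ 1 + A $ 2 $ 2 * x t $ 2 + c $ 2) = trace A * v t - D * x t $ 1 + f * D"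
      unfolding fD unfolding Ddef trace_2 v_def by algebra
    also have "\<dots> = 2 * s * v t - D * (x t $ 1 - f)" unfolding Ts by algebra
    finally show ?thesis .
  qed
  have eq: "focus_coord A c (x t) = of_real (x t $ 1 - f) + \<i> * of_real ((s * (x t $ 1 - f) - v t) / m)" for t
    by (simp add: focus_coord_def f_def s_def m_def D_def v_def mult_fst complex_eq_iff)
  have re: "((\<lambda>t. x t $ 1 - f) has_real_derivative v t) (at t within S)"
    using d1 by (auto intro!: derivative_eq_intros simp: v_def)
  have im: "((\<lambda>t. (s * (x t $ 1 - f) - v t) / m) has_real_derivative
      (s * v t - (2 * s * v t - D * (x t $ 1 - f))) / m) (at t within S)"
    by (rule DERIV_cdivide[OF DERIV_diff[OF DERIV_cmult[OF re] dv]])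
  have "((\<lambda>t. focus_coord A c (x t)) has_vector_derivative
      of_real (v t) + \<i> * of_real ((s * v t - (2 * s * v t - D * (x t $ 1 - f))) / m)) (at t within S)"
    unfolding eq
    by (intro has_vector_derivative_add has_vector_derivative_mult_right
        has_vector_derivative_of_real re im)
  also have "of_real (v t) + \<i> * of_real ((s * v t - (2 * s * v t - D * (x t $ 1 - f))) / m)
      = focus_eigenvalue A * focus_coord A c (x t)"
    unfolding eq focus_eigenvalue_def s_def[symmetric] m_def[symmetric] Dsm
    using m by (simp add: complex_eq_iff field_simps power2_eq_square)
  finally show ?thesis .
qed

lemma focus_coord_flow:
  assumes F: "(trace A)\<^sup>2 - 4 * det A < 0"
    and x: "\<And>r. r \<in> {s..t} \<Longrightarrow> (x has_vector_derivative A *v x r + c) (at r within {s..t})"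
    and r: "r \<in> {s..t}"
  shows "focus_coord A c (x r) = exp (focus_eigenvalue A * of_real (r - s)) * focus_coord A c (x s)"
proof -
  define l where "l = focus_eigenvalue A"
  \<comment> \<open>Rotating back along the flow makes the coordinate constant.\<close>
  define w where "w = (\<lambda>r. exp (- l * of_real (r - s)) * focus_coord A c (x r))"
  have "(w has_vector_derivative 0) (at r within {s..t})" if "r \<in> {s..t}" for r
  proof -
    have e: "((\<lambda>r. exp (- l * of_real (r - s))) has_vector_derivative - l * exp (- l * of_real (r - s))) (at r within {s..t})"
    proof -
      have "((\<lambda>z. exp (- l * (z - of_real s))) has_field_derivative - l * exp (- l * (of_real r - of_real s))) (at (of_real r))"
        by (auto intro!: derivative_eq_intros)
      from has_vector_derivative_real_field[OF this] show ?thesis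
        using has_vector_derivative_at_within by fastforce
    qed
    show ?thesis unfolding w_def
      using has_vector_derivative_mult[OF e focus_coord_has_derivative[OF F x[OF that]]]
      by (simp add: l_def)
  qed
  then obtain k where "\<And>r. r \<in> {s..t} \<Longrightarrow> w r = k"
    using has_vector_derivative_zero_constant[of "{s..t}" w] by (metis convex_real_interval(5))
  then have "w r = w s" using r by simp
  then have "exp (l * of_real (r - s)) * w r = exp (l * of_real (r - s)) * focus_coord A c (x s)"
    by (simp add: w_def)
  then show ?thesis by (simp add: w_def l_def mult.assoc[symmetric] exp_add[symmetric])
qed

section \<open>The integral relation between the ends of an arc\<close>

text \<open>The first return of a spiral \<open>k e\<^bsup>st\<^esup> cis (\<theta> + m t)\<close> to a vertical line off the focus, coming from
  the left. If the line lies to the left of the focus (\<open>k < 0\<close>), the arc stays in a half-plane that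
  avoids the focus and the angle grows without passing a full turn. If it lies to the right, the arc
  goes round the focus: without leaving the right half-plane it could not turn back, because
  \<open>tan\<close> increases. Nor can it take a full turn, which multiplies position and velocity by
  \<open>e\<^bsup>2\<pi>s/m\<^esup>\<close>: if this factor is less than \<open>1\<close>, the line is no longer reached; otherwise the line was
  met before or is met in the wrong direction.\<close>
lemma half_turn_angle:
  fixes s m k \<theta> \<tau> :: real
  assumes m: "m > 0" and \<tau>: "\<tau> > 0" and k: "k \<noteq> 0" and \<theta>: "- pi / 2 < \<theta>" "\<theta> < pi / 2"
    and R: "\<And>t. R t = k * exp (s * t) * cos (\<theta> + m * t)"
    and V: "\<And>t. V t = k * exp (s * t) * (s * cos (\<theta> + m * t) - m * sin (\<theta> + m * t))"
    and ret: "R \<tau> = R 0" and less: "\<And>t. 0 < t \<Longrightarrow> t < \<tau> \<Longrightarrow> R t < R 0"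
    and v: "V 0 < 0" "V \<tau> > 0"
  shows "\<theta> + m * \<tau> - (if k < 0 then 0 else 2 * pi) \<in> {- pi / 2<..<pi / 2}"
proof -
  have c0: "cos \<theta> > 0" using cos_gt_zero_pi[of \<theta>] \<theta> by simp
  have m\<tau>: "m * \<tau> > 0" using m \<tau> by simp
  show ?thesis
  proof (cases "k < 0")
    case True
    have R0: "R 0 < 0" using True c0 by (simp add: R mult_neg_pos)
    have "\<theta> + m * \<tau> < pi / 2"
    proof (rule ccontr)
      assume A: "\<not> \<theta> + m * \<tau> < pi / 2"
      define t where "t = (pi / 2 - \<theta>) / m"
      have t: "0 < t" "t \<le> \<tau>" "\<theta> + m * t = pi / 2" using A \<theta> m by (auto simp: t_def field_simps)
      have "R t = 0" unfolding R t(3) by simp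
      then show False using less[of t] t ret R0 by (cases "t = \<tau>") auto
    qed
    then show ?thesis using True \<theta> m\<tau> by auto
  next
    case False
    then have kp: "k > 0" using k by simp
    have R0: "R 0 > 0" using kp c0 by (simp add: R)
    have c1: "cos (\<theta> + m * \<tau>) > 0"
    proof -
      have "R \<tau> > 0" using ret R0 by simp
      moreover have "k * exp (s * \<tau>) > 0" using kp by simp
      ultimately show ?thesis unfolding R by (rule zero_less_mult_pos)
    qed
    have "\<not> \<theta> + m * \<tau> < pi / 2"
    proof
      assume A: "\<theta> + m * \<tau> < pi / 2"
      have "s * cos \<theta> - m * sin \<theta> < 0" using v(1) kp by (simp add: V mult_less_0_iff)
      then have 1: "s < m * tan \<theta>" using c0 by (simp add: tan_def field_simps)
      have "s * cos (\<theta> + m * \<tau>) - m * sin (\<theta> + m * \<tau>) > 0" 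
      proof -
        have "k * exp (s * \<tau>) > 0" using kp by simp
        then show ?thesis using v(2) unfolding V by (rule zero_less_mult_pos[rotated])
      qed
      then have 2: "s > m * tan (\<theta> + m * \<tau>)" using c1 by (simp add: tan_def field_simps)
      have "tan \<theta> < tan (\<theta> + m * \<tau>)" using A \<theta> m\<tau> by (intro tan_monotone) auto
      then have "m * tan \<theta> < m * tan (\<theta> + m * \<tau>)" using m by simp
      then show False using 1 2 by linarith
    qed
    moreover have "\<not> (pi / 2 \<le> \<theta> + m * \<tau> \<and> \<theta> + m * \<tau> \<le> 3 * pi / 2)"
    proof
      assume A: "pi / 2 \<le> \<theta> + m * \<tau> \<and> \<theta> + m * \<tau> \<le> 3 * pi / 2"
      have "cos (\<theta> + m * \<tau> - pi) \<ge> 0" using A by (intro cos_ge_zero) auto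
      then show False using c1 by (simp add: cos_diff)
    qed
    moreover have "m * \<tau> < 2 * pi"
    proof (rule ccontr)
      assume A: "\<not> m * \<tau> < 2 * pi"
      define \<tau>0 where "\<tau>0 = 2 * pi / m"
      have \<tau>0: "\<tau>0 > 0" "\<tau>0 \<le> \<tau>" "m * \<tau>0 = 2 * pi" using A m by (auto simp: \<tau>0_def field_simps)
      have per: "R (t + \<tau>0) = exp (s * \<tau>0) * R t" "V (t + \<tau>0) = exp (s * \<tau>0) * V t" for t
      proof -
        have "\<theta> + m * (t + \<tau>0) = (\<theta> + m * t) + 2 * pi" by (simp add: distrib_left \<tau>0(3))
        then have cs: "cos (\<theta> + m * (t + \<tau>0)) = cos (\<theta> + m * t)" "sin (\<theta> + m * (t + \<tau>0)) = sin (\<theta> + m * t)"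
          by (simp_all only: cos_periodic sin_periodic)
        show "R (t + \<tau>0) = exp (s * \<tau>0) * R t" "V (t + \<tau>0) = exp (s * \<tau>0) * V t"
          unfolding R V cs by (simp_all add: distrib_left exp_add)
      qed
      show False
      proof (cases "s < 0")
        case True
        have "s * \<tau>0 < 0" using True \<tau>0 by (simp add: mult_neg_pos)
        then have e: "0 < exp (s * \<tau>0)" "exp (s * \<tau>0) < 1" by simp_all
        have "R (\<tau> - \<tau>0) \<le> R 0" using less[of "\<tau> - \<tau>0"] \<tau>0 by (cases "\<tau> = \<tau>0") auto
        then have "exp (s * \<tau>0) * R (\<tau> - \<tau>0) \<le> exp (s * \<tau>0) * R 0" by simp
        also have "\<dots> < R 0" using e R0 by simp
        finally show False using per(1)[of "\<tau> - \<tau>0"] ret by simp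
      next
        case False
        then have "exp (s * \<tau>0) \<ge> 1" using \<tau>0 by simp
        then have "R 0 \<le> R \<tau>0" using per(1)[of 0] R0 by simp
        then have "\<tau> = \<tau>0" using less[of \<tau>0] \<tau>0 by fastforce
        then show False using per(2)[of 0] v by (simp add: zero_less_mult_iff)
      qed
    qed
    ultimately show ?thesis using False \<theta> by auto
  qed
qed

text \<open>A primitive of \<open>v / (v\<^sup>2 + 2 s f v + (s\<^sup>2 + m\<^sup>2) f\<^sup>2)\<close>. Up to a constant it is
  \<open>ln |z| - (s / m) arg z\<close>, which is conserved along the spirals of the focus with eigenvalue
  \<open>s + i m\<close>, read off at the point of the line \<open>Re z = - f\<close> with horizontal velocity \<open>v\<close>.\<close>
definition half_map_integral :: "real \<Rightarrow> real \<Rightarrow> real \<Rightarrow> real \<Rightarrow> real" where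
  "half_map_integral s m f v =
     ln (v\<^sup>2 + 2 * s * f * v + (s\<^sup>2 + m\<^sup>2) * f\<^sup>2) / 2 - s / m * arctan ((s * f + v) / (m * f))"

text \<open>Invariance under the half turn \<open>z \<mapsto> - z\<close>, which lets one lemma treat arcs on both sides.\<close>
lemma half_map_integral_minus: "half_map_integral s m (- f) (- v) = half_map_integral s m f v"
proof -
  have "s * - f + - v = - (s * f + v)" "m * - f = - (m * f)" by simp_all
  then have "(s * - f + - v) / (m * - f) = (s * f + v) / (m * f)" by (simp only: minus_divide_divide)
  then show ?thesis unfolding half_map_integral_def by simp
qed

lemma half_map_denom_pos:
  fixes s m f v :: real
  assumes "m > 0" "f \<noteq> 0"
  shows "v\<^sup>2 + 2 * s * f * v + (s\<^sup>2 + m\<^sup>2) * f\<^sup>2 > 0"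
proof -
  have "v\<^sup>2 + 2 * s * f * v + (s\<^sup>2 + m\<^sup>2) * f\<^sup>2 = (s * f + v)\<^sup>2 + (m * f)\<^sup>2"
    by (simp add: power2_eq_square algebra_simps)
  also have "\<dots> > 0" using assms by (simp add: add_nonneg_pos)
  finally show ?thesis .
qed

lemma half_map_integral_has_derivative:
  assumes m: "m > 0" and f: "f \<noteq> 0"
  shows "(half_map_integral s m f has_real_derivative v / (v\<^sup>2 + 2 * s * f * v + (s\<^sup>2 + m\<^sup>2) * f\<^sup>2)) (at v)"
proof -
  define Q where "Q = v\<^sup>2 + 2 * s * f * v + (s\<^sup>2 + m\<^sup>2) * f\<^sup>2"
  have Q: "Q > 0" unfolding Q_def by (rule half_map_denom_pos[OF assms])
  have Q2: "Q = (m * f)\<^sup>2 + (s * f + v)\<^sup>2" by (simp add: Q_def power2_eq_square algebra_simps)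
  have "((\<lambda>v. ln (v\<^sup>2 + 2 * s * f * v + (s\<^sup>2 + m\<^sup>2) * f\<^sup>2) / 2) has_real_derivative (2 * v + 2 * s * f) / Q / 2) (at v)"
  proof -
    have "((\<lambda>v. v\<^sup>2 + 2 * s * f * v + (s\<^sup>2 + m\<^sup>2) * f\<^sup>2) has_real_derivative 2 * v + 2 * s * f) (at v)"
      by (auto intro!: derivative_eq_intros)
    from DERIV_cdivide[OF DERIV_chain2[OF DERIV_ln_divide[OF Q[unfolded Q_def]] this], of 2] show ?thesis
      by (simp add: Q_def)
  qed
  moreover have "((\<lambda>v. s / m * arctan ((s * f + v) / (m * f))) has_real_derivative
      s / m * (inverse (1 + ((s * f + v) / (m * f))\<^sup>2) * (1 / (m * f)))) (at v)"
    using m f by (auto intro!: derivative_eq_intros simp: mult_ac)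
  ultimately have "(half_map_integral s m f has_real_derivative (2 * v + 2 * s * f) / Q / 2 -
      s / m * (inverse (1 + ((s * f + v) / (m * f))\<^sup>2) * (1 / (m * f)))) (at v)"
    unfolding half_map_integral_def[abs_def] by (rule DERIV_diff)
  also have "s / m * (inverse (1 + ((s * f + v) / (m * f))\<^sup>2) * (1 / (m * f))) = s * f / Q"
  proof -
    have "1 + ((s * f + v) / (m * f))\<^sup>2 = Q / (m * f)\<^sup>2"
    proof -
      have "1 + (a / b)\<^sup>2 = (b\<^sup>2 + a\<^sup>2) / b\<^sup>2" if "b \<noteq> 0" for a b :: real
        using that by (simp add: power_divide add_divide_distrib)
      then show ?thesis unfolding Q2 using m f by (metis less_irrefl mult_eq_0_iff)
    qed
    then have inv: "inverse (1 + ((s * f + v) / (m * f))\<^sup>2) = (m * f)\<^sup>2 / Q" by simp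
    show ?thesis unfolding inv using m f by (simp add: power2_eq_square)
  qed
  also have "(2 * v + 2 * s * f) / Q / 2 - s * f / Q = v / Q"
    by (simp add: add_divide_distrib)
  finally show ?thesis by (simp add: Q_def)
qed

lemma half_map_integral_mono:
  assumes m: "m > 0" and f: "f \<noteq> 0" and uv: "u < v"
  shows "0 \<le> u \<Longrightarrow> half_map_integral s m f u < half_map_integral s m f v"
    and "v \<le> 0 \<Longrightarrow> half_map_integral s m f v < half_map_integral s m f u"
proof -
  have c: "continuous_on S (half_map_integral s m f)" for S
    using DERIV_isCont[OF half_map_integral_has_derivative[OF m f]]
    by (simp add: continuous_at_imp_continuous_on)
  show "half_map_integral s m f u < half_map_integral s m f v" if "0 \<le> u"
  proof (rule DERIV_pos_imp_increasing_open[OF uv _ c])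
    fix x assume "u < x" "x < v"
    then have "x / (x\<^sup>2 + 2 * s * f * x + (s\<^sup>2 + m\<^sup>2) * f\<^sup>2) > 0"
      using that half_map_denom_pos[OF m f] by simp
    then show "\<exists>y. (half_map_integral s m f has_real_derivative y) (at x) \<and> 0 < y"
      using half_map_integral_has_derivative[OF m f] by blast
  qed
  show "half_map_integral s m f v < half_map_integral s m f u" if "v \<le> 0"
  proof (rule DERIV_neg_imp_decreasing_open[OF uv _ c])
    fix x assume "u < x" "x < v"
    then have "x / (x\<^sup>2 + 2 * s * f * x + (s\<^sup>2 + m\<^sup>2) * f\<^sup>2) < 0"
      using that half_map_denom_pos[OF m f] by (simp add: divide_neg_pos)
    then show "\<exists>y. (half_map_integral s m f has_real_derivative y) (at x) \<and> y < 0"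
      using half_map_integral_has_derivative[OF m f] by blast
  qed
qed

lemma half_map_integral_eq_norm_arctan:
  assumes m: "m > 0" and f: "f \<noteq> 0" and z: "Re z = - f" and v: "v = Re (Complex s m * z)"
  shows "half_map_integral s m f v = ln m + ln (norm z) - s / m * arctan (Im z / Re z)"
proof -
  have v': "s * f + v = - (m * Im z)" using v z by simp
  have z0: "z \<noteq> 0" using z f by auto
  have "v\<^sup>2 + 2 * s * f * v + (s\<^sup>2 + m\<^sup>2) * f\<^sup>2 = (s * f + v)\<^sup>2 + m\<^sup>2 * f\<^sup>2"
    by (simp add: power2_eq_square algebra_simps)
  also have "\<dots> = m\<^sup>2 * (norm z)\<^sup>2" unfolding v' cmod_power2 z by (simp add: power_mult_distrib algebra_simps)
  also have "\<dots> = (m * norm z)\<^sup>2" by (simp add: power_mult_distrib)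
  finally have "ln (v\<^sup>2 + 2 * s * f * v + (s\<^sup>2 + m\<^sup>2) * f\<^sup>2) = 2 * ln (m * norm z)"
    using m z0 by (simp add: ln_realpow)
  also have "\<dots> = 2 * (ln m + ln (norm z))" using m z0 by (simp add: ln_mult)
  finally show ?thesis unfolding half_map_integral_def v' z using m by simp
qed

text \<open>Along the arc \<open>ln |z|\<close> grows by \<open>s \<tau>\<close> and the angle by \<open>m \<tau>\<close>; the values of \<open>arctan\<close> at the
  two ends differ from the angle by a full turn exactly when the arc goes round the focus.\<close>
lemma half_turn_integral:
  assumes m: "m > 0" and f: "f \<noteq> 0" and \<tau>: "\<tau> > 0"
    and z: "\<And>t. t \<in> {0..\<tau>} \<Longrightarrow> z t = exp (Complex s m * of_real t) * z 0"
    and ends: "Re (z 0) = - f" "Re (z \<tau>) = - f"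
    and left: "\<And>t. 0 < t \<Longrightarrow> t < \<tau> \<Longrightarrow> Re (z t) < - f"
    and v0: "Re (Complex s m * z 0) < 0" and v1: "Re (Complex s m * z \<tau>) > 0"
  shows "half_map_integral s m f (Re (Complex s m * z \<tau>)) - half_map_integral s m f (Re (Complex s m * z 0))
           = (if f > 0 then 0 else 2 * pi * s / m)"
proof -
  define \<theta> where "\<theta> = arctan (Im (z 0) / Re (z 0))"
  \<comment> \<open>Polar form with an angle in \<open>(-\<pi>/2, \<pi>/2)\<close>; the sign of \<open>k\<close> tells on which side of the focus
    the line lies.\<close>
  define k where "k = - sgn f * norm (z 0)"
  have \<theta>: "- pi / 2 < \<theta>" "\<theta> < pi / 2" using arctan_bounded[of "Im (z 0) / Re (z 0)"] by (auto simp: \<theta>_def)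
  have c0: "cos \<theta> > 0" using cos_gt_zero_pi[of \<theta>] \<theta> by simp
  have z00: "z 0 \<noteq> 0" using ends f by auto
  have k: "k \<noteq> 0" using z00 f by (simp add: k_def sgn_zero_iff)
  have kf: "k < 0 \<longleftrightarrow> f > 0" using z00 f by (auto simp: k_def sgn_if)
  have z0: "z 0 = of_real k * cis \<theta>"
  proof -
    have t: "tan \<theta> = Im (z 0) / Re (z 0)" by (simp add: \<theta>_def tan_arctan)
    then have im: "Im (z 0) = Re (z 0) * tan \<theta>" using ends f by simp
    have "(norm (z 0))\<^sup>2 = (Re (z 0))\<^sup>2 * (1 + (tan \<theta>)\<^sup>2)"
      by (simp add: cmod_power2 im power_mult_distrib algebra_simps)
    also have "\<dots> = (Re (z 0) / cos \<theta>)\<^sup>2"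
      using c0 tan_sec[of \<theta>] by (simp add: power_divide inverse_eq_divide)
    finally have "sqrt ((norm (z 0))\<^sup>2) = sqrt ((Re (z 0) / cos \<theta>)\<^sup>2)" by (rule arg_cong)
    then have "norm (z 0) = \<bar>Re (z 0) / cos \<theta>\<bar>" by (simp only: real_sqrt_abs abs_norm_cancel)
    then have "k = - (sgn f * \<bar>f\<bar>) / cos \<theta>" unfolding k_def using c0 ends(1) by (simp add: abs_divide)
    then have "k = Re (z 0) / cos \<theta>" unfolding mult_sgn_abs using ends(1) by simp
    then have "Re (z 0) = k * cos \<theta>" using c0 by simp
    moreover from this have "Im (z 0) = k * sin \<theta>" using im c0 by (simp add: tan_def)
    ultimately show ?thesis by (simp add: complex_eq_iff)
  qed
  have zt: "z t = of_real (k * exp (s * t)) * cis (\<theta> + m * t)" if "t \<in> {0..\<tau>}" for t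
  proof -
    have "exp (Complex s m * of_real t) = of_real (exp (s * t)) * cis (m * t)"
      by (simp add: exp_eq_polar)
    then show ?thesis using z[OF that] z0 by (simp add: cis_mult[symmetric] mult_ac)
  qed
  define R where "R = (\<lambda>t. k * exp (s * t) * cos (\<theta> + m * t))"
  define V where "V = (\<lambda>t. k * exp (s * t) * (s * cos (\<theta> + m * t) - m * sin (\<theta> + m * t)))"
  have RV: "Re (z t) = R t" "Re (Complex s m * z t) = V t" if "t \<in> {0..\<tau>}" for t
    unfolding zt[OF that] R_def V_def by (simp_all add: algebra_simps)
  have "\<theta> + m * \<tau> - (if k < 0 then 0 else 2 * pi) \<in> {- pi / 2<..<pi / 2}"
  proof (rule half_turn_angle[OF m \<tau> k \<theta>])
    show "R t = k * exp (s * t) * cos (\<theta> + m * t)"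
      "V t = k * exp (s * t) * (s * cos (\<theta> + m * t) - m * sin (\<theta> + m * t))" for t
      by (simp_all add: R_def V_def)
    have in0: "0 \<in> {0..\<tau>}" and in\<tau>: "\<tau> \<in> {0..\<tau>}" using \<tau> by auto
    show "R \<tau> = R 0" using RV(1)[OF in0] RV(1)[OF in\<tau>] ends by simp
    show "R t < R 0" if "0 < t" "t < \<tau>" for t
      using RV(1)[OF in0] RV(1)[of t] ends left[OF that] that by simp
    show "V 0 < 0" "V \<tau> > 0"
      unfolding RV(2)[OF in0, symmetric] RV(2)[OF in\<tau>, symmetric] by (rule v0 v1)+
  qed
  moreover define \<psi> where "\<psi> = \<theta> + m * \<tau> - (if k < 0 then 0 else 2 * pi)"
  ultimately have \<psi>: "- pi / 2 < \<psi>" "\<psi> < pi / 2" by auto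
  have "cis \<psi> = cis (\<theta> + m * \<tau>)"
    by (simp add: \<psi>_def complex_eq_iff cos_diff sin_diff)
  then have z\<tau>: "z \<tau> = of_real (k * exp (s * \<tau>)) * cis \<psi>" using zt[of \<tau>] \<tau> by simp
  have "Im (z \<tau>) / Re (z \<tau>) = tan \<psi>" unfolding z\<tau> using k by (simp add: tan_def)
  then have a\<tau>: "arctan (Im (z \<tau>) / Re (z \<tau>)) = \<psi>" using \<psi> by (simp add: arctan_tan)
  have "norm (z \<tau>) = exp (s * \<tau>) * norm (z 0)" unfolding z\<tau> z0 by (simp add: norm_mult)
  then have "ln (norm (z \<tau>)) = s * \<tau> + ln (norm (z 0))" using z00 by (simp add: ln_mult)
  then show ?thesis
    unfolding half_map_integral_eq_norm_arctan[OF m f ends(1) refl] half_map_integral_eq_norm_arctan[OF m f ends(2) refl] a\<tau>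
    using m kf by (auto simp: \<theta>_def[symmetric] \<psi>_def field_simps)
qed

text \<open>The side of the line on which the arc runs is coded by \<open>e\<close>: the arc lies in \<open>e x\<^sub>1 > 0\<close>. The
  right-hand side does not mention the end points, so all arcs on one side share it.\<close>
lemma focus_arc_integral:
  assumes F: "(trace A)\<^sup>2 - 4 * det A < 0" and a: "forcing A c \<noteq> 0"
    and st: "s < t" and e: "e = 1 \<or> e = -1"
    and x: "\<And>r. r \<in> {s..t} \<Longrightarrow> (x has_vector_derivative A *v x r + c) (at r within {s..t})"
    and ends: "x s $ 1 = 0" "x t $ 1 = 0" and side: "\<And>r. r \<in> {s<..<t} \<Longrightarrow> e * x r $ 1 > 0"
    and vs: "e * (A *v x s + c) $ 1 > 0" and vt: "e * (A *v x t + c) $ 1 < 0"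
  shows "half_map_integral (focus_re A) (focus_im A) (forcing A c / det A) ((A *v x t + c) $ 1)
       - half_map_integral (focus_re A) (focus_im A) (forcing A c / det A) ((A *v x s + c) $ 1)
       = (if e * forcing A c < 0 then 0 else 2 * pi * focus_re A / focus_im A)"
proof -
  define f where "f = forcing A c / det A"
  \<comment> \<open>For \<open>e = 1\<close> the half turn moves the arc to the left of the line.\<close>
  define z where "z = (\<lambda>r. - of_real e * focus_coord A c (x (s + r)))"
  have D: "det A > 0" by (rule det_pos_of_focus[OF F])
  have f: "f \<noteq> 0" "e * f < 0 \<longleftrightarrow> e * forcing A c < 0"
    using a D by (auto simp: f_def divide_less_0_iff)
  have vel: "Re (Complex (focus_re A) (focus_im A) * z r) = - e * (A *v x (s + r) + c) $ 1" for r
    unfolding focus_coord_velocity[OF F] z_def focus_eigenvalue_def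
    using e by auto
  have rez: "Re (z r) = - e * (x (s + r) $ 1 - f)" for r by (simp add: z_def focus_coord_def f_def)
  have m: "focus_im A > 0" by (rule focus_im_pos[OF F])
  have "half_map_integral (focus_re A) (focus_im A) (- e * f) (Re (Complex (focus_re A) (focus_im A) * z (t - s)))
       - half_map_integral (focus_re A) (focus_im A) (- e * f) (Re (Complex (focus_re A) (focus_im A) * z 0))
       = (if - e * f > 0 then 0 else 2 * pi * focus_re A / focus_im A)"
  proof (rule half_turn_integral[OF m])
    show "- e * f \<noteq> 0" using e f by auto
    show "0 < t - s" using st by simp
    show "z r = exp (Complex (focus_re A) (focus_im A) * complex_of_real r) * z 0" if "r \<in> {0..t - s}" for r
      using focus_coord_flow[OF F x, of "s + r"] that by (simp add: z_def focus_eigenvalue_def)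
    show "Re (z 0) = - (- e * f)" "Re (z (t - s)) = - (- e * f)" using ends by (simp_all add: rez)
    show "Re (z r) < - (- e * f)" if "0 < r" "r < t - s" for r
      using side[of "s + r"] that unfolding rez by (simp add: right_diff_distrib)
    show "Re (Complex (focus_re A) (focus_im A) * z 0) < 0" "Re (Complex (focus_re A) (focus_im A) * z (t - s)) > 0"
      unfolding vel using vs vt by simp_all
  qed
  moreover have "half_map_integral s m (- e * f) (- e * w) = half_map_integral s m f w" for s m w
    using e half_map_integral_minus by auto
  ultimately show ?thesis unfolding vel f_def[symmetric] f(2)[symmetric] by simp
qed

section \<open>Zeros of continuous functions and periodicity\<close>

text \<open>Positivity just after \<open>t\<close> keeps the infimum of the later nonpositive times away from \<open>t\<close>.\<close>
lemma first_zero_after: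
  fixes g :: "real \<Rightarrow> real"
  assumes cont: "continuous_on UNIV g" and d: "d > 0" and pos: "\<And>r. r \<in> {t<..<t + d} \<Longrightarrow> g r > 0"
    and u: "u > t" "g u \<le> 0"
  obtains t' where "t < t'" "g t' = 0" "\<And>r. r \<in> {t<..<t'} \<Longrightarrow> g r > 0"
proof -
  define S where "S = {t + d / 2..} \<inter> {r. g r \<le> 0}"
  have "closed {r. g r \<le> 0}" using cont by (intro closed_Collect_le continuous_intros)
  then have "closed S" unfolding S_def by (intro closed_Int) auto
  moreover have "u \<in> S" using pos[of u] u d by (force simp: S_def)
  moreover have "bdd_below S" by (auto simp: S_def)
  ultimately have inS: "Inf S \<in> S" by (intro closed_contains_Inf) auto
  have least: "Inf S \<le> r" if "r \<in> S" for r using that \<open>bdd_below S\<close> by (rule cInf_lower)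
  have "g (Inf S) \<ge> 0"
  proof (rule ccontr)
    assume neg: "\<not> g (Inf S) \<ge> 0"
    have "\<exists>r\<ge>t + d / 2. r \<le> Inf S \<and> g r = 0"
      using neg inS pos[of "t + d / 2"] d cont
      by (intro IVT2') (auto simp: S_def intro: continuous_on_subset)
    then obtain r where r: "t + d / 2 \<le> r" "r \<le> Inf S" "g r = 0" by blast
    then have "r = Inf S" using least[of r] by (auto simp: S_def)
    then show False using r neg by simp
  qed
  then have "g (Inf S) = 0" using inS by (simp add: S_def)
  moreover have "t < Inf S" using inS d by (simp add: S_def)
  moreover have "g r > 0" if "r \<in> {t<..<Inf S}" for r
    using pos[of r] least[of r] that d by (force simp: S_def)
  ultimately show ?thesis using that by blast
qed

lemma last_zero_before:
  fixes g :: "real \<Rightarrow> real"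
  assumes cont: "continuous_on UNIV g" and d: "d > 0" and pos: "\<And>r. r \<in> {t - d<..<t} \<Longrightarrow> g r > 0"
    and u: "u < t" "g u \<le> 0"
  obtains t' where "t' < t" "g t' = 0" "\<And>r. r \<in> {t'<..<t} \<Longrightarrow> g r > 0"
proof -
  have "continuous_on UNIV (\<lambda>r. g (- r))"
    by (rule continuous_on_compose2[OF cont]) (auto intro: continuous_intros)
  then obtain t' where t': "- t < t'" "g (- t') = 0" "\<And>r. r \<in> {- t<..<t'} \<Longrightarrow> g (- r) > 0"
    by (rule first_zero_after[OF _ d, where t = "- t" and u = "- u"]) (use pos u in auto)
  show ?thesis
  proof (rule that[of "- t'"])
    show "g r > 0" if "r \<in> {- t'<..<t}" for r using t'(3)[of "- r"] that by auto
  qed (use t' in auto)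
qed

lemma periodic_future_and_past:
  fixes x :: "real \<Rightarrow> 'a"
  assumes "T > 0" "\<And>t. x (t + T) = x t"
  shows "\<exists>u>t. x u = x s" "\<exists>u<t. x u = x s"
proof -
  have p: "x (t + of_nat n * T) = x t" for n t
    by (induction n) (simp_all add: distrib_right assms(2) add.assoc[symmetric] add.commute[of T])
  have m: "x (t - of_nat n * T) = x t" for n t using p[of "t - of_nat n * T" n] by simp
  obtain n where "t - s < of_nat n * T" using reals_Archimedean3[OF assms(1)] by blast
  then show "\<exists>u>t. x u = x s" using p[of s n] by (intro exI[of _ "s + of_nat n * T"]) auto
  obtain n where "s - t < of_nat n * T" using reals_Archimedean3[OF assms(1)] by blast
  then show "\<exists>u<t. x u = x s" using m[of s n] by (intro exI[of _ "s - of_nat n * T"]) auto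
qed

lemma sgn_times_pos: "a \<noteq> 0 \<Longrightarrow> sgn a * a > 0" for a :: real
  by (simp add: sgn_if)

lemma filippov_set_off_line:
  "p $ 1 < 0 \<Longrightarrow> filippov_set fL fR p = {fL p}" "p $ 1 > 0 \<Longrightarrow> filippov_set fL fR p = {fR p}"
  by (simp_all add: filippov_set_def)

lemma periodic_range_eq:
  fixes x :: "real \<Rightarrow> 'a"
  assumes T: "T > 0" and per: "\<And>t. x (t + T) = x t"
  shows "range x = x ` {0..T}"
proof -
  have "x t \<in> x ` {0..T}" for t
  proof -
    obtain u where u: "u > 0" "x u = x t" using periodic_future_and_past(1)[where x = x, OF T per] by blast
    have p: "x (r + of_nat n * T) = x r" for n r
      by (induction n) (simp_all add: distrib_right per add.assoc[symmetric] add.commute[of T])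
    define n where "n = nat \<lfloor>u / T\<rfloor>"
    have "of_nat n \<le> u / T" "u / T < of_nat n + 1" using u T by (simp_all add: n_def)
    then have "u - of_nat n * T \<in> {0..T}" using T by (auto simp: field_simps)
    moreover have "x (u - of_nat n * T) = x t" using p[of "u - of_nat n * T" n] u by simp
    ultimately show ?thesis by (metis imageI)
  qed
  then show ?thesis by blast
qed

section \<open>Crossing motions of two foci\<close>

locale two_foci =
  fixes AL AR :: "real^2^2" and bL bR :: "real^2"
  assumes a12: "AL $ 1 $ 2 * AR $ 1 $ 2 > 0"
    and FL: "(trace AL)\<^sup>2 - 4 * det AL < 0" and FR: "(trace AR)\<^sup>2 - 4 * det AR < 0"
begin

abbreviation "fL \<equiv> (\<lambda>p. AL *v p + bL)"
abbreviation "fR \<equiv> (\<lambda>p. AR *v p + bR)"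

text \<open>The half-plane that a crossing motion occupies just after passing through \<open>p\<close>.\<close>
definition side :: "real^2 \<Rightarrow> real" where
  "side p = sgn (if p $ 1 = 0 then fL p $ 1 else p $ 1)"

text \<open>The parametrised form of a crossing periodic orbit; the orbit itself is the range.\<close>
definition crossing_motion :: "(real \<Rightarrow> real^2) \<Rightarrow> bool" where
  "crossing_motion x \<longleftrightarrow> filippov_solution fL fR x \<and> (\<exists>T>0. \<forall>t. x (t + T) = x t) \<and>
     (\<exists>t. x t $ 1 < 0) \<and> (\<exists>t. x t $ 1 > 0) \<and> (\<forall>t. x t $ 1 = 0 \<longrightarrow> crossing_point fL fR (x t))"

lemma crossing_periodic_orbit_iff:
  "crossing_periodic_orbit fL fR \<Gamma> \<longleftrightarrow> (\<exists>x. crossing_motion x \<and> \<Gamma> = range x)"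
proof
  assume "crossing_periodic_orbit fL fR \<Gamma>"
  then show "\<exists>x. crossing_motion x \<and> \<Gamma> = range x"
    unfolding crossing_periodic_orbit_def crossing_motion_def by (elim conjE exE bexE) blast
next
  assume "\<exists>x. crossing_motion x \<and> \<Gamma> = range x"
  then show "crossing_periodic_orbit fL fR \<Gamma>"
    unfolding crossing_periodic_orbit_def crossing_motion_def by (elim conjE exE) (intro conjI, blast+)
qed

lemma crossing_motion_solution: "crossing_motion x \<Longrightarrow> filippov_solution fL fR x"
  by (simp add: crossing_motion_def)

lemma crossing_motion_signs:
  assumes "crossing_motion x" "x t $ 1 = 0"
  shows "fL (x t) $ 1 \<noteq> 0" "fR (x t) $ 1 \<noteq> 0" "e * fL (x t) $ 1 > 0 \<longleftrightarrow> e * fR (x t) $ 1 > 0"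
    "e * fL (x t) $ 1 < 0 \<longleftrightarrow> e * fR (x t) $ 1 < 0"
proof -
  have *: "fL (x t) $ 1 * fR (x t) $ 1 > 0"
    using assms unfolding crossing_motion_def crossing_point_def by blast
  then show "fL (x t) $ 1 \<noteq> 0" "fR (x t) $ 1 \<noteq> 0" by (auto simp del: vector_add_component)
  have "(e * y > 0 \<longleftrightarrow> e * z > 0) \<and> (e * y < 0 \<longleftrightarrow> e * z < 0)" if "y * z > 0" for y z :: real
    using that by (auto simp: zero_less_mult_iff mult_less_0_iff)
  then show "e * fL (x t) $ 1 > 0 \<longleftrightarrow> e * fR (x t) $ 1 > 0" "e * fL (x t) $ 1 < 0 \<longleftrightarrow> e * fR (x t) $ 1 < 0"
    using * by blast+
qed

lemma crossing_motion_crosses: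
  assumes x: "crossing_motion x" and t: "x t $ 1 = 0" and pos: "e * fL (x t) $ 1 > 0"
  obtains d where "d > 0" "\<And>r. r \<in> {t<..<t + d} \<Longrightarrow> e * x r $ 1 > 0"
    "\<And>r. r \<in> {t - d<..<t} \<Longrightarrow> e * x r $ 1 < 0"
proof -
  have "e * fR (x t) $ 1 > 0" using pos crossing_motion_signs(3)[OF x t] by blast
  then show ?thesis
    using filippov_solution_crosses[OF crossing_motion_solution[OF x] continuous_on_affine_field continuous_on_affine_field t pos] that
    by blast
qed

lemma side_cases: "crossing_motion x \<Longrightarrow> side (x t) = 1 \<or> side (x t) = - 1"
  using crossing_motion_signs(1)[of x t] unfolding side_def sgn_if by (simp split: if_splits)

lemma crossing_motion_side:
  assumes x: "crossing_motion x"
  obtains d where "d > 0" "\<And>r. r \<in> {0<..<d} \<Longrightarrow> side (x t) * x (t + r) $ 1 > 0"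
proof (cases "x t $ 1 = 0")
  case True
  have "side (x t) * fL (x t) $ 1 > 0"
    unfolding side_def if_P[OF True] by (rule sgn_times_pos[OF crossing_motion_signs(1)[OF x True]])
  from crossing_motion_crosses[OF x True this] obtain d where
    "d > 0" "\<And>r. r \<in> {t<..<t + d} \<Longrightarrow> side (x t) * x r $ 1 > 0" by metis
  then show ?thesis using that[of d] by auto
next
  case False
  have "isCont (\<lambda>r. side (x t) * x r $ 1) t"
    using filippov_solution_continuous[OF crossing_motion_solution[OF x], of UNIV]
    by (intro continuous_intros) (simp add: continuous_on_eq_continuous_at)
  moreover have "side (x t) * x t $ 1 > 0"
    unfolding side_def if_not_P[OF False] by (rule sgn_times_pos[OF False])
  ultimately have "\<forall>\<^sub>F r in at t. side (x t) * x r $ 1 > 0" by (metis isContD order_tendstoD(1))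
  then obtain d where d: "d > 0" "\<And>r. r \<noteq> t \<Longrightarrow> dist r t < d \<Longrightarrow> side (x t) * x r $ 1 > 0"
    unfolding eventually_at by blast
  show ?thesis using d by (intro that[of d]) (auto simp: dist_real_def)
qed

lemma left_arc_derivative:
  assumes "filippov_solution fL fR x" "\<And>r. r \<in> {s<..<t} \<Longrightarrow> x r $ 1 < 0" "r \<in> {s..t}"
  shows "(x has_vector_derivative fL (x r)) (at r within {s..t})"
  using assms by (intro filippov_solution_smooth_arc[OF _ continuous_on_affine_field]) (auto simp: filippov_set_off_line)

lemma right_arc_derivative:
  assumes "filippov_solution fL fR x" "\<And>r. r \<in> {s<..<t} \<Longrightarrow> x r $ 1 > 0" "r \<in> {s..t}"
  shows "(x has_vector_derivative fR (x r)) (at r within {s..t})"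
  using assms by (intro filippov_solution_smooth_arc[OF _ continuous_on_affine_field]) (auto simp: filippov_set_off_line)

lemma linear_arc_unique:
  fixes A :: "real^2^2"
  assumes A: "A $ 1 $ 2 \<noteq> 0" "(trace A)\<^sup>2 - 4 * det A < 0"
    and x: "\<And>r. r \<in> {s..s + l} \<Longrightarrow> (x has_vector_derivative A *v x r + c) (at r within {s..s + l})"
    and y: "\<And>r. r \<in> {s'..s' + l} \<Longrightarrow> (y has_vector_derivative A *v y r + c) (at r within {s'..s' + l})"
    and eq: "x s = y s'" and r: "0 \<le> r" "r \<le> l"
  shows "x (s + r) = y (s' + r)"
proof (rule focus_coord_inj[OF A])
  show "focus_coord A c (x (s + r)) = focus_coord A c (y (s' + r))"
    using focus_coord_flow[OF A(2) x, of "s + r"] focus_coord_flow[OF A(2) y, of "s' + r"] r eq by simp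
qed

lemma crossing_motion_unique_locally:
  assumes x: "crossing_motion x" and y: "crossing_motion y" and eq: "x s = y s'"
  obtains d where "d > 0" "\<And>r. 0 \<le> r \<Longrightarrow> r \<le> d \<Longrightarrow> x (s + r) = y (s' + r)"
proof -
  obtain d1 where d1: "d1 > 0" "\<And>r. r \<in> {0<..<d1} \<Longrightarrow> side (x s) * x (s + r) $ 1 > 0"
    using crossing_motion_side[OF x] by blast
  obtain d2 where d2: "d2 > 0" "\<And>r. r \<in> {0<..<d2} \<Longrightarrow> side (x s) * y (s' + r) $ 1 > 0"
    using crossing_motion_side[OF y, of s'] unfolding eq[symmetric] by blast
  define d where "d = min d1 d2"
  have d: "d > 0" using d1 d2 by (simp add: d_def)
  have sx: "side (x s) * x r $ 1 > 0" if "r \<in> {s<..<s + d}" for r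
    using d1(2)[of "r - s"] that by (auto simp: d_def min_def split: if_splits)
  have sy: "side (x s) * y r $ 1 > 0" if "r \<in> {s'<..<s' + d}" for r
    using d2(2)[of "r - s'"] that by (auto simp: d_def min_def split: if_splits)
  have nz: "AL $ 1 $ 2 \<noteq> 0" "AR $ 1 $ 2 \<noteq> 0" using a12 by auto
  note sol = crossing_motion_solution[OF x] crossing_motion_solution[OF y]
  consider "side (x s) = 1" | "side (x s) = - 1" using side_cases[OF x] by blast
  then show ?thesis
  proof cases
    case 1
    show ?thesis
      by (rule that[OF d], rule linear_arc_unique[OF nz(2) FR, where x = x and y = y and c = bR and l = d])
        (use sx sy 1 eq in \<open>auto intro!: right_arc_derivative sol\<close>)
  next
    case 2
    show ?thesis
      by (rule that[OF d], rule linear_arc_unique[OF nz(1) FL, where x = x and y = y and c = bL and l = d])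
        (use sx sy 2 eq in \<open>auto intro!: left_arc_derivative sol\<close>)
  qed
qed

text \<open>At the infimum of the times at which the two motions differ they still agree, and they agree for
  some time afterwards.\<close>
lemma crossing_motion_unique_forward:
  assumes x: "crossing_motion x" and y: "crossing_motion y" and eq: "x s = y s'" and r: "0 \<le> r"
  shows "x (s + r) = y (s' + r)"
proof (rule ccontr)
  assume neq: "x (s + r) \<noteq> y (s' + r)"
  define d where "d = (\<lambda>r. x (s + r) - y (s' + r))"
  define B where "B = {r. 0 \<le> r \<and> d r \<noteq> 0}"
  have B: "r \<in> B" "bdd_below B" using neq r by (auto simp: B_def d_def)
  define q where "q = Inf B"
  have low: "q \<le> u" if "u \<in> B" for u unfolding q_def using that B(2) by (rule cInf_lower)
  have q0: "q \<ge> 0" unfolding q_def using B by (intro cInf_greatest) (auto simp: B_def)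
  have "continuous_on UNIV d" unfolding d_def
    by (intro continuous_intros continuous_on_compose2[OF filippov_solution_continuous[OF crossing_motion_solution[OF x], of UNIV]]
      continuous_on_compose2[OF filippov_solution_continuous[OF crossing_motion_solution[OF y], of UNIV]]) auto
  have "d q = 0"
  proof (rule ccontr)
    assume nz: "d q \<noteq> 0"
    then have "q \<noteq> 0" using eq by (auto simp: d_def)
    then have qp: "q > 0" using q0 by simp
    have "isCont d q" using \<open>continuous_on UNIV d\<close> by (simp add: continuous_on_eq_continuous_at)
    then have "\<forall>\<^sub>F u in at q. d u \<noteq> 0" using nz by (metis isContD tendsto_imp_eventually_ne)
    then obtain h where h: "h > 0" "\<And>u. u \<noteq> q \<Longrightarrow> dist u q < h \<Longrightarrow> d u \<noteq> 0"
      unfolding eventually_at by blast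
    define u where "u = max (q - h / 2) (q / 2)"
    have "u < q" "u \<ge> 0" "dist u q < h" using h(1) qp by (auto simp: u_def dist_real_def max_def)
    then have "u \<in> B" using h(2)[of u] by (simp add: B_def)
    then show False using low \<open>u < q\<close> by fastforce
  qed
  then have "x (s + q) = y (s' + q)" by (simp add: d_def)
  then obtain h where h: "h > 0" "\<And>r. 0 \<le> r \<Longrightarrow> r \<le> h \<Longrightarrow> x (s + q + r) = y (s' + q + r)"
    using crossing_motion_unique_locally[OF x y] by blast
  have "q + h \<le> u" if "u \<in> B" for u
    using h(2)[of "u - q"] low[OF that] that by (force simp: B_def d_def)
  then have "q + h \<le> Inf B" using B by (intro cInf_greatest) auto
  then show False using h(1) by (simp add: q_def)
qed

text \<open>By periodicity the forward half of a motion already covers its orbit, so forward uniqueness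
  suffices.\<close>
lemma crossing_orbits_meeting_eq:
  assumes x: "crossing_motion x" and y: "crossing_motion y" and eq: "x s = y s'"
  shows "range x = range y"
proof -
  have sub: "range x \<subseteq> range y"
    if x: "crossing_motion x" and y: "crossing_motion y" and eq: "x s = y s'" for x y s s'
  proof
    fix p assume "p \<in> range x"
    then obtain t where t: "p = x t" by blast
    obtain T where "T > 0" "\<And>t. x (t + T) = x t" using x by (auto simp: crossing_motion_def)
    then obtain u where u: "u > s" "x u = x t" using periodic_future_and_past(1) by metis
    have "x (s + (u - s)) = y (s' + (u - s))"
      using u by (intro crossing_motion_unique_forward[OF x y eq]) simp
    then show "p \<in> range y" using t u by (metis add.commute diff_add_cancel rangeI)
  qed
  show ?thesis using sub[OF x y eq] sub[OF y x eq[symmetric]] by blast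
qed

lemma arc_forward:
  assumes x: "crossing_motion x" and t: "x t $ 1 = 0" and e: "e = 1 \<or> e = - 1" and v: "e * fL (x t) $ 1 > 0"
  obtains t' where "t < t'" "x t' $ 1 = 0" "\<And>r. r \<in> {t<..<t'} \<Longrightarrow> e * x r $ 1 > 0" "e * fL (x t') $ 1 < 0"
proof -
  obtain d where d: "d > 0" "\<And>r. r \<in> {t<..<t + d} \<Longrightarrow> e * x r $ 1 > 0"
    using crossing_motion_crosses[OF x t v] by metis
  obtain s where s: "e * x s $ 1 < 0" using x e by (auto simp: crossing_motion_def)
  obtain T where "T > 0" "\<And>t. x (t + T) = x t" using x by (auto simp: crossing_motion_def)
  then obtain u where u: "u > t" "x u = x s" using periodic_future_and_past(1) by metis
  have "continuous_on UNIV (\<lambda>r. e * x r $ 1)"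
    by (intro continuous_intros filippov_solution_continuous[OF crossing_motion_solution[OF x]])
  then obtain t' where t': "t < t'" "e * x t' $ 1 = 0" "\<And>r. r \<in> {t<..<t'} \<Longrightarrow> e * x r $ 1 > 0"
    by (rule first_zero_after[OF _ d, where u = u]) (use u s in auto)
  have z: "x t' $ 1 = 0" using t'(2) e by auto
  have "\<not> e * fL (x t') $ 1 > 0"
  proof
    assume "e * fL (x t') $ 1 > 0"
    then obtain d where d: "d > 0" "\<And>r. r \<in> {t' - d<..<t'} \<Longrightarrow> e * x r $ 1 < 0"
      using crossing_motion_crosses[OF x z] by metis
    obtain r where "max t (t' - d) < r" "r < t'" using dense[of "max t (t' - d)" t'] t'(1) d(1) by auto
    then show False using d(2)[of r] t'(3)[of r] by auto
  qed
  moreover have "e * fL (x t') $ 1 \<noteq> 0" using crossing_motion_signs(1)[OF x z] e by (auto simp del: vector_add_component)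
  ultimately have "e * fL (x t') $ 1 < 0" by linarith
  then show ?thesis using that t' z by blast
qed

lemma arc_backward:
  assumes x: "crossing_motion x" and t: "x t $ 1 = 0" and e: "e = 1 \<or> e = - 1" and v: "e * fL (x t) $ 1 < 0"
  obtains t' where "t' < t" "x t' $ 1 = 0" "\<And>r. r \<in> {t'<..<t} \<Longrightarrow> e * x r $ 1 > 0" "e * fL (x t') $ 1 > 0"
proof -
  have "- e * fL (x t) $ 1 > 0" using v by simp
  then obtain d where d: "d > 0" "\<And>r. r \<in> {t - d<..<t} \<Longrightarrow> - e * x r $ 1 < 0"
    using crossing_motion_crosses[OF x t] by metis
  obtain s where s: "e * x s $ 1 < 0" using x e by (auto simp: crossing_motion_def)
  obtain T where "T > 0" "\<And>t. x (t + T) = x t" using x by (auto simp: crossing_motion_def)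
  then obtain u where u: "u < t" "x u = x s" using periodic_future_and_past(2) by metis
  have "continuous_on UNIV (\<lambda>r. e * x r $ 1)"
    by (intro continuous_intros filippov_solution_continuous[OF crossing_motion_solution[OF x]])
  then obtain t' where t': "t' < t" "e * x t' $ 1 = 0" "\<And>r. r \<in> {t'<..<t} \<Longrightarrow> e * x r $ 1 > 0"
    by (rule last_zero_before[OF _ d(1), where u = u]) (use u s d(2) in auto)
  have z: "x t' $ 1 = 0" using t'(2) e by auto
  have "\<not> - e * fL (x t') $ 1 > 0"
  proof
    assume "- e * fL (x t') $ 1 > 0"
    then obtain d where d: "d > 0" "\<And>r. r \<in> {t'<..<t' + d} \<Longrightarrow> - e * x r $ 1 > 0"
      using crossing_motion_crosses[OF x z] by metis
    obtain r where "t' < r" "r < min t (t' + d)" using dense[of t' "min t (t' + d)"] t'(1) d(1) by auto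
    then show False using d(2)[of r] t'(3)[of r] by auto
  qed
  moreover have "e * fL (x t') $ 1 \<noteq> 0" using crossing_motion_signs(1)[OF x z] e by (auto simp del: vector_add_component)
  ultimately have "e * fL (x t') $ 1 > 0" by linarith
  then show ?thesis using that t' z by blast
qed

end

section \<open>The sign condition\<close>

text \<open>A derivative that vanishes at one point does not spoil strict monotonicity: compare through
  that point.\<close>
lemma strict_decreasing_off_one_point:
  fixes g :: "real \<Rightarrow> real"
  assumes uv: "u < v" and d: "\<And>w. u \<le> w \<Longrightarrow> w \<le> v \<Longrightarrow> (g has_real_derivative g' w) (at w)"
    and neg: "\<And>w. u \<le> w \<Longrightarrow> w \<le> v \<Longrightarrow> w \<noteq> c \<Longrightarrow> g' w < 0"
  shows "g v < g u"
proof -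
  have dec: "g t < g s" if st: "s < t" "u \<le> s" "t \<le> v" "c \<notin> {s<..<t}" for s t
  proof (rule DERIV_neg_imp_decreasing_open[OF st(1)])
    show "\<exists>y. (g has_real_derivative y) (at x) \<and> y < 0" if "s < x" "x < t" for x
      using d[of x] neg[of x] st that by auto
    show "continuous_on {s..t} g"
      by (intro continuous_at_imp_continuous_on ballI DERIV_isCont[OF d]) (use st in auto)
  qed
  show ?thesis
  proof (cases "c \<in> {u<..<v}")
    case True
    then have "g c < g u" "g v < g c" using dec[of u c] dec[of c v] by auto
    then show ?thesis by simp
  next
    case False
    then show ?thesis using dec uv by simp
  qed
qed

text \<open>The left-hand side is the numerator of \<open>b\<close> times the difference of the two slopes
  \<open>w / (w\<^sup>2 + P w + r\<^sub>L\<^sup>2)\<close> and \<open>(w + b) / ((w + b)\<^sup>2 + Q (w + b) + r\<^sub>R\<^sup>2)\<close>. Replacing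
  \<open>b\<^sup>2 + b (Q - P)\<close> by \<open>- (r\<^sub>L - r\<^sub>R)\<^sup>2\<close> completes it to minus a square.\<close>
lemma slope_difference_numerator:
  fixes b w P Q rL rR :: real
  assumes "w * (w + b) > 0" and H: "(rL - rR)\<^sup>2 + b\<^sup>2 + b * (Q - P) \<le> 0"
  shows "b * (w * ((w + b)\<^sup>2 + Q * (w + b) + rR\<^sup>2) - (w + b) * (w\<^sup>2 + P * w + rL\<^sup>2))
           \<le> - ((rL - rR) * w + rL * b)\<^sup>2"
proof -
  have "b * (w * ((w + b)\<^sup>2 + Q * (w + b) + rR\<^sup>2) - (w + b) * (w\<^sup>2 + P * w + rL\<^sup>2))
      = w * (w + b) * ((rL - rR)\<^sup>2 + b\<^sup>2 + b * (Q - P)) - ((rL - rR) * w + rL * b)\<^sup>2"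
    by algebra
  also have "\<dots> \<le> - ((rL - rR) * w + rL * b)\<^sup>2"
    using mult_nonneg_nonpos[OF less_imp_le[OF assms(1)] H] by simp
  finally show ?thesis .
qed

text \<open>With \<open>r = |a| / \<surd>D\<close> on either side, \<open>\<Delta>\<close> factors as \<open>(D\<^sub>L D\<^sub>R)\<^sup>2 (X\<^sup>2 - (2 r\<^sub>L r\<^sub>R)\<^sup>2)\<close> for
  a certain \<open>X\<close>, and the claim is \<open>X \<le> 2 r\<^sub>L r\<^sub>R\<close>.\<close>
lemma Delta_nonpos_imp:
  fixes TL TR DL DR aL aR b :: real
  assumes D: "DL > 0" "DR > 0" and Delta: "Delta TL TR DL DR aL aR b \<le> 0"
  shows "(\<bar>aL\<bar> / sqrt DL - \<bar>aR\<bar> / sqrt DR)\<^sup>2 + b\<^sup>2 + b * (TR * aR / DR - TL * aL / DL) \<le> 0"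
proof -
  define rL where "rL = \<bar>aL\<bar> / sqrt DL"
  define rR where "rR = \<bar>aR\<bar> / sqrt DR"
  define X where "X = rL\<^sup>2 + rR\<^sup>2 + b\<^sup>2 + b * (TR * aR / DR - TL * aL / DL)"
  have r: "rL \<ge> 0" "rR \<ge> 0" "rL\<^sup>2 = aL\<^sup>2 / DL" "rR\<^sup>2 = aR\<^sup>2 / DR"
    using D by (simp_all add: rL_def rR_def power_divide)
  have "DR * (aL\<^sup>2 - aL * b * TL + b\<^sup>2 * DL) + aR\<^sup>2 * DL + aR * b * DL * TR = DL * DR * X"
    unfolding X_def r using D by (simp add: field_simps)
  moreover have "4 * aL\<^sup>2 * aR\<^sup>2 * DL * DR = (DL * DR)\<^sup>2 * (2 * rL * rR)\<^sup>2"
    unfolding power_mult_distrib r using D by (simp add: field_simps power2_eq_square)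
  ultimately have "Delta TL TR DL DR aL aR b = (DL * DR)\<^sup>2 * (X\<^sup>2 - (2 * rL * rR)\<^sup>2)"
    unfolding Delta_def by (simp add: power_mult_distrib right_diff_distrib)
  then have "X\<^sup>2 - (2 * rL * rR)\<^sup>2 \<le> 0" using Delta D by (simp add: mult_le_0_iff)
  then have "X\<^sup>2 \<le> (2 * rL * rR)\<^sup>2" by simp
  then have "X \<le> 2 * rL * rR" by (rule power2_le_imp_le) (simp add: r(1,2))
  then show ?thesis unfolding X_def rL_def[symmetric] rR_def[symmetric] by (simp add: power2_diff)
qed

section \<open>Loops and their uniqueness\<close>

context two_foci
begin

text \<open>The scaling of the right field that gives both fields the same slope along the line; then the
  first components differ there by the constant \<open>offset\<close>.\<close>
definition ratio :: real where "ratio = AL $ 1 $ 2 / AR $ 1 $ 2"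

definition offset :: real where "offset = ratio * bR $ 1 - bL $ 1"

definition left_integral :: "real \<Rightarrow> real" where
  "left_integral = half_map_integral (focus_re AL) (focus_im AL) (forcing AL bL / det AL)"

definition right_integral :: "real \<Rightarrow> real" where
  "right_integral = half_map_integral (focus_re AR) (focus_im AR) (forcing AR bR / det AR)"

lemma ratio_pos: "ratio > 0"
  using a12 by (auto simp: ratio_def zero_less_mult_iff intro: divide_pos_pos divide_neg_neg)

lemma velocities_on_line: "p $ 1 = 0 \<Longrightarrow> ratio * fR p $ 1 = fL p $ 1 + offset"
proof -
  assume p: "p $ 1 = 0"
  have "AR $ 1 $ 2 \<noteq> 0" using a12 by auto
  then have "ratio * AR $ 1 $ 2 = AL $ 1 $ 2" by (simp add: ratio_def)
  then have "ratio * (AR $ 1 $ 2 * p $ 2) = AL $ 1 $ 2 * p $ 2" by (metis mult.assoc)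
  then show ?thesis unfolding field_fst using p by (simp add: offset_def distrib_left)
qed

lemma eq_on_line: "p $ 1 = 0 \<Longrightarrow> q $ 1 = 0 \<Longrightarrow> fL p $ 1 = fL q $ 1 \<Longrightarrow> p = q"
  using a12 unfolding field_fst by (auto simp: vec_eq_iff forall_2)

lemma fR_mono_on_line:
  assumes "p $ 1 = 0" "q $ 1 = 0"
  shows "fR p $ 1 \<le> fR q $ 1 \<longleftrightarrow> fL p $ 1 \<le> fL q $ 1"
proof -
  have "fL p $ 1 \<le> fL q $ 1 \<longleftrightarrow> ratio * fR p $ 1 \<le> ratio * fR q $ 1"
    unfolding velocities_on_line[OF assms(1)] velocities_on_line[OF assms(2)] by linarith
  then show ?thesis using ratio_pos by (simp del: vector_add_component)
qed

end

locale two_forced_foci = two_foci +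
  assumes aL: "forcing AL bL \<noteq> 0" and aR: "forcing AR bR \<noteq> 0"
begin

lemma left_integral_le_iff:
  "0 \<le> u \<Longrightarrow> 0 \<le> v \<Longrightarrow> left_integral u \<le> left_integral v \<longleftrightarrow> u \<le> v"
  "u \<le> 0 \<Longrightarrow> v \<le> 0 \<Longrightarrow> left_integral u \<le> left_integral v \<longleftrightarrow> v \<le> u"
  using half_map_integral_mono[OF focus_im_pos[OF FL], of "forcing AL bL / det AL"] aL det_pos_of_focus[OF FL]
  unfolding left_integral_def by (smt (verit) divide_eq_0_iff)+

lemma right_integral_le_iff:
  "0 \<le> u \<Longrightarrow> 0 \<le> v \<Longrightarrow> right_integral u \<le> right_integral v \<longleftrightarrow> u \<le> v"
  "u \<le> 0 \<Longrightarrow> v \<le> 0 \<Longrightarrow> right_integral u \<le> right_integral v \<longleftrightarrow> v \<le> u"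
  using half_map_integral_mono[OF focus_im_pos[OF FR], of "forcing AR bR / det AR"] aR det_pos_of_focus[OF FR]
  unfolding right_integral_def by (smt (verit) divide_eq_0_iff)+

definition left_const :: real where
  "left_const = (if - 1 * forcing AL bL < 0 then 0 else 2 * pi * focus_re AL / focus_im AL)"

definition right_const :: real where
  "right_const = (if 1 * forcing AR bR < 0 then 0 else 2 * pi * focus_re AR / focus_im AR)"

lemma left_arc_integral:
  assumes x: "crossing_motion x" and st: "s < t" and ends: "x s $ 1 = 0" "x t $ 1 = 0"
    and side: "\<And>r. r \<in> {s<..<t} \<Longrightarrow> - 1 * x r $ 1 > 0"
    and v: "- 1 * fL (x s) $ 1 > 0" "- 1 * fL (x t) $ 1 < 0"
  shows "left_integral (fL (x t) $ 1) - left_integral (fL (x s) $ 1) = left_const"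
  unfolding left_integral_def left_const_def
  by (rule focus_arc_integral[OF FL aL st _ left_arc_derivative[OF crossing_motion_solution[OF x]] ends side v])
    (use side in auto)

lemma right_arc_integral:
  assumes x: "crossing_motion x" and st: "s < t" and ends: "x s $ 1 = 0" "x t $ 1 = 0"
    and side: "\<And>r. r \<in> {s<..<t} \<Longrightarrow> 1 * x r $ 1 > 0"
    and v: "1 * fL (x s) $ 1 > 0" "1 * fL (x t) $ 1 < 0"
  shows "right_integral (fR (x t) $ 1) - right_integral (fR (x s) $ 1) = right_const"
proof -
  have v': "1 * fR (x s) $ 1 > 0" "1 * fR (x t) $ 1 < 0"
    using v crossing_motion_signs(3,4)[OF x] ends by blast+
  show ?thesis
    unfolding right_integral_def right_const_def
    by (rule focus_arc_integral[OF FR aR st _ right_arc_derivative[OF crossing_motion_solution[OF x]] ends side v'])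
      (use side in auto)
qed

text \<open>The trace on the line of a closed orbit with one arc on either side: \<open>p\<close> is where it enters the
  left half-plane and \<open>q\<close> where it leaves. The arcs themselves enter only through their integral
  relations.\<close>
definition fixed_loop :: "real^2 \<Rightarrow> real^2 \<Rightarrow> bool" where
  "fixed_loop p q \<longleftrightarrow> p $ 1 = 0 \<and> q $ 1 = 0 \<and> fL p $ 1 < 0 \<and> fR p $ 1 < 0 \<and> fL q $ 1 > 0 \<and> fR q $ 1 > 0 \<and>
     left_integral (fL q $ 1) - left_integral (fL p $ 1) = left_const \<and>
     right_integral (fR p $ 1) - right_integral (fR q $ 1) = right_const"

lemma crossing_motion_enters_left:
  assumes x: "crossing_motion x"
  obtains t where "x t $ 1 = 0" "fL (x t) $ 1 < 0"
proof -
  obtain s u where su: "x s $ 1 < 0" "x u $ 1 > 0" using x by (auto simp: crossing_motion_def)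
  have "connected (range (\<lambda>t. x t $ 1))"
    by (intro connected_continuous_image continuous_intros filippov_solution_continuous[OF crossing_motion_solution[OF x]]) auto
  then have "0 \<in> range (\<lambda>t. x t $ 1)"
    using su connectedD_interval[of "range (\<lambda>t. x t $ 1)" "x s $ 1" "x u $ 1" 0] by auto
  then obtain t where t: "x t $ 1 = 0" by auto
  show ?thesis
  proof (cases "fL (x t) $ 1 < 0")
    case False
    then have "1 * fL (x t) $ 1 > 0" using crossing_motion_signs(1)[OF x t] by linarith
    from arc_forward[OF x t _ this] obtain t' where "x t' $ 1 = 0" "1 * fL (x t') $ 1 < 0" by metis
    then show ?thesis using that[of t'] by (simp only: mult_1)
  qed (use t that in blast)
qed

text \<open>Let \<open>p\<close> be the crossing into the left half-plane with least velocity. Both half-return maps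
  are decreasing, so its image under the return map is at most the image of its predecessor under
  the return map, which is \<open>p\<close>; by minimality the image is \<open>p\<close> itself.\<close>
lemma crossing_motion_fixed_loop:
  assumes x: "crossing_motion x"
  obtains p q where "p \<in> range x" "fixed_loop p q"
proof -
  obtain T where T: "T > 0" "\<And>t. x (t + T) = x t" using x by (auto simp: crossing_motion_def)
  define C where "C = range x \<inter> {p. p $ 1 = 0} \<inter> {p. fL p $ 1 \<le> 0}"
  have "compact (range x)" unfolding periodic_range_eq[where x = x, OF T]
    by (intro compact_continuous_image filippov_solution_continuous[OF crossing_motion_solution[OF x]]) auto
  moreover have "closed {p::real^2. p $ 1 = 0}" by (intro closed_Collect_eq continuous_intros)
  moreover have contL: "continuous_on S (\<lambda>p. fL p $ 1)" for S
    by (intro continuous_on_component continuous_on_affine_field)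
  then have "closed {p. fL p $ 1 \<le> 0}" by (intro closed_Collect_le continuous_on_const)
  ultimately have "compact C" unfolding C_def by (intro compact_Int_closed)
  have "C \<noteq> {}"
  proof -
    obtain t where "x t $ 1 = 0" "fL (x t) $ 1 < 0" using crossing_motion_enters_left[OF x] .
    then have "x t \<in> C" unfolding C_def by (intro IntI CollectI rangeI less_imp_le)
    then show ?thesis by blast
  qed
  obtain p0 where p0: "p0 \<in> C" "\<And>p. p \<in> C \<Longrightarrow> fL p0 $ 1 \<le> fL p $ 1"
    using continuous_attains_inf[OF \<open>compact C\<close> \<open>C \<noteq> {}\<close> contL] by metis
  then obtain t0 where t0: "p0 = x t0" "x t0 $ 1 = 0" "fL (x t0) $ 1 \<le> 0" by (auto simp: C_def)
  then have v0: "fL (x t0) $ 1 < 0" using crossing_motion_signs(1)[OF x t0(2)] by linarith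
  have least: "fL (x t0) $ 1 \<le> fL (x t) $ 1" if "x t $ 1 = 0" "1 * fL (x t) $ 1 < 0" for t
    using p0(2)[of "x t"] that t0(1) by (auto simp: C_def simp del: vector_add_component)
  have sR: "fL (x t) $ 1 < 0 \<longleftrightarrow> fR (x t) $ 1 < 0" "fL (x t) $ 1 > 0 \<longleftrightarrow> fR (x t) $ 1 > 0" if "x t $ 1 = 0" for t
    using crossing_motion_signs(3,4)[OF x that, of 1] by (simp_all only: mult_1)
  have v0': "- 1 * fL (x t0) $ 1 > 0" "1 * fL (x t0) $ 1 < 0" using v0 by linarith+
  \<comment> \<open>The crossings \<open>t1\<close>, \<open>t2\<close> after \<open>t0\<close> and \<open>s1\<close>, \<open>s2\<close> before it.\<close>
  obtain t1 where t1: "t0 < t1" "x t1 $ 1 = 0" "\<And>r. r \<in> {t0<..<t1} \<Longrightarrow> - 1 * x r $ 1 > 0" "- 1 * fL (x t1) $ 1 < 0"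
    using arc_forward[OF x t0(2) _ v0'(1)] by metis
  have v1: "1 * fL (x t1) $ 1 > 0" using t1(4) by linarith
  obtain t2 where t2: "t1 < t2" "x t2 $ 1 = 0" "\<And>r. r \<in> {t1<..<t2} \<Longrightarrow> 1 * x r $ 1 > 0" "1 * fL (x t2) $ 1 < 0"
    using arc_forward[OF x t1(2) _ v1] by metis
  obtain s1 where s1: "s1 < t0" "x s1 $ 1 = 0" "\<And>r. r \<in> {s1<..<t0} \<Longrightarrow> 1 * x r $ 1 > 0" "1 * fL (x s1) $ 1 > 0"
    using arc_backward[OF x t0(2) _ v0'(2)] by metis
  have w1: "- 1 * fL (x s1) $ 1 < 0" using s1(4) by linarith
  obtain s2 where s2: "s2 < s1" "x s2 $ 1 = 0" "\<And>r. r \<in> {s2<..<s1} \<Longrightarrow> - 1 * x r $ 1 > 0" "- 1 * fL (x s2) $ 1 > 0"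
    using arc_backward[OF x s1(2) _ w1] by metis
  have L: "left_integral (fL (x t1) $ 1) - left_integral (fL (x t0) $ 1) = left_const"
    "left_integral (fL (x s1) $ 1) - left_integral (fL (x s2) $ 1) = left_const"
    using left_arc_integral[OF x t1(1) t0(2) t1(2) t1(3) v0'(1) t1(4)]
      left_arc_integral[OF x s2(1,2) s1(2) s2(3,4) w1] by blast+
  have R: "right_integral (fR (x t2) $ 1) - right_integral (fR (x t1) $ 1) = right_const"
    "right_integral (fR (x t0) $ 1) - right_integral (fR (x s1) $ 1) = right_const"
    using right_arc_integral[OF x t2(1) t1(2) t2(2) t2(3) v1 t2(4)]
      right_arc_integral[OF x s1(1,2) t0(2) s1(3,4) v0'(2)] by blast+
  have "fL (x t0) $ 1 \<le> fL (x s2) $ 1" using least[OF s2(2)] s2(4) by linarith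
  then have "left_integral (fL (x s2) $ 1) \<le> left_integral (fL (x t0) $ 1)"
    using left_integral_le_iff(2)[of "fL (x s2) $ 1" "fL (x t0) $ 1"] s2(4) v0 by linarith
  then have "left_integral (fL (x s1) $ 1) \<le> left_integral (fL (x t1) $ 1)" using L by linarith
  then have "fL (x s1) $ 1 \<le> fL (x t1) $ 1"
    using left_integral_le_iff(1)[of "fL (x s1) $ 1" "fL (x t1) $ 1"] s1(4) v1 by linarith
  then have "fR (x s1) $ 1 \<le> fR (x t1) $ 1" using fR_mono_on_line s1(2) t1(2) by blast
  moreover have "fR (x s1) $ 1 > 0" "fR (x t1) $ 1 > 0"
    using sR(2) s1(2,4) t1(2) v1 by (simp_all only: mult_1)
  ultimately have "right_integral (fR (x s1) $ 1) \<le> right_integral (fR (x t1) $ 1)"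
    using right_integral_le_iff(1)[of "fR (x s1) $ 1" "fR (x t1) $ 1"] by linarith
  then have "right_integral (fR (x t0) $ 1) \<le> right_integral (fR (x t2) $ 1)" using R by linarith
  moreover have f0: "fR (x t0) $ 1 < 0" "fR (x t2) $ 1 < 0"
    using sR(1) t0(2) v0 t2(2,4) by (simp_all only: mult_1)
  ultimately have "fR (x t2) $ 1 \<le> fR (x t0) $ 1"
    using right_integral_le_iff(2)[of "fR (x t0) $ 1" "fR (x t2) $ 1"] by linarith
  moreover have "fR (x t0) $ 1 \<le> fR (x t2) $ 1"
    using least[OF t2(2,4)] fR_mono_on_line t0(2) t2(2) by blast
  ultimately have same: "fR (x t2) $ 1 = fR (x t0) $ 1" by linarith
  have "fixed_loop (x t0) (x t1)"
    unfolding fixed_loop_def using t0(2) t1(2) v0 f0(1) v1 \<open>fR (x t1) $ 1 > 0\<close> L(1) R(1)[unfolded same]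
    by (simp only: mult_1)
  then show ?thesis using that by blast
qed

text \<open>Two loops with different \<open>p\<close> would be nested, and the function \<open>\<Psi>\<close> below, being strictly
  monotone in the same sense on both sides of \<open>0\<close>, cannot have the same total increment over both.\<close>
lemma fixed_loop_unique:
  assumes b: "offset \<noteq> 0"
    and H: "Delta (trace AL) (trace AR) (det AL) (det AR) (forcing AL bL) (ratio * forcing AR bR) offset \<le> 0"
    and pq: "fixed_loop p q" and pq': "fixed_loop p' q'"
  shows "p = p'"
proof -
  define b where "b = offset"
  define sL where "sL = focus_re AL"
  define mL where "mL = focus_im AL"
  define gL where "gL = forcing AL bL / det AL"
  define sR where "sR = focus_re AR"
  define mR where "mR = focus_im AR"
  define gR where "gR = forcing AR bR / det AR"
  define k where "k = ratio"
  have k: "k > 0" using ratio_pos by (simp add: k_def)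
  have D: "det AL > 0" "det AR > 0" using det_pos_of_focus FL FR by blast+
  have m: "mL > 0" "mR > 0" using focus_im_pos FL FR by (auto simp: mL_def mR_def)
  have g: "gL \<noteq> 0" "gR \<noteq> 0" using aL aR D by (auto simp: gL_def gR_def)
  define rL where "rL = \<bar>forcing AL bL\<bar> / sqrt (det AL)"
  define rR where "rR = \<bar>k * forcing AR bR\<bar> / sqrt (det AR)"
  define P where "P = 2 * sL * gL"
  define Q where "Q = k * (2 * sR * gR)"
  have rL: "rL\<^sup>2 = (sL\<^sup>2 + mL\<^sup>2) * gL\<^sup>2" "rL \<noteq> 0"
    using D(1) aL unfolding sL_def mL_def det_eq_focus[OF FL, symmetric]
    by (simp_all add: rL_def gL_def power_divide power2_eq_square)
  have rR: "rR\<^sup>2 = k\<^sup>2 * ((sR\<^sup>2 + mR\<^sup>2) * gR\<^sup>2)"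
    using D(2) unfolding sR_def mR_def det_eq_focus[OF FR, symmetric]
    by (simp add: rR_def gR_def power_divide power2_eq_square)
  have H': "(rL - rR)\<^sup>2 + b\<^sup>2 + b * (Q - P) \<le> 0"
    using Delta_nonpos_imp[OF D H] unfolding rL_def rR_def b_def k_def P_def Q_def sL_def sR_def gL_def gR_def focus_re_def
    by (simp add: mult_ac)
  \<comment> \<open>Multiplying by \<open>b\<close> makes \<open>\<Psi>\<close> decreasing whatever the sign of \<open>b\<close>.\<close>
  define \<Psi> where "\<Psi> = (\<lambda>w. b * (left_integral w - right_integral ((w + b) / k)))"
  define QL where "QL = (\<lambda>w. w\<^sup>2 + P * w + rL\<^sup>2)"
  define QR where "QR = (\<lambda>w. (w + b)\<^sup>2 + Q * (w + b) + rR\<^sup>2)"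
  have QLp: "QL w > 0" for w
    using half_map_denom_pos[OF m(1) g(1), of w sL] by (simp add: QL_def P_def rL)
  \<comment> \<open>Scaling by \<open>k\<close> expresses the right slope in the velocity of the left field.\<close>
  have QR_eq: "QR w = k\<^sup>2 * (((w + b) / k)\<^sup>2 + 2 * sR * gR * ((w + b) / k) + (sR\<^sup>2 + mR\<^sup>2) * gR\<^sup>2)" for w
  proof -
    have "k\<^sup>2 * ((X / k)\<^sup>2 + c * (X / k) + d) = X\<^sup>2 + k * c * X + k\<^sup>2 * d" for X c d
      using k by (simp add: power2_eq_square field_simps)
    then show ?thesis unfolding QR_def Q_def rR by simp
  qed
  have QRp: "QR w > 0" for w
    unfolding QR_eq using k by (intro mult_pos_pos half_map_denom_pos[OF m(2) g(2)]) simp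
  define \<psi> where "\<psi> = (\<lambda>w. b * (w / QL w - (w + b) / QR w))"
  have der: "(\<Psi> has_real_derivative \<psi> w) (at w)" for w
  proof -
    have 1: "(left_integral has_real_derivative w / QL w) (at w)"
      using half_map_integral_has_derivative[OF m(1) g(1), of sL w]
      unfolding left_integral_def QL_def rL P_def sL_def mL_def gL_def .
    have "(right_integral has_real_derivative ((w + b) / k) / (QR w / k\<^sup>2)) (at ((w + b) / k))"
      using half_map_integral_has_derivative[OF m(2) g(2), of sR "(w + b) / k"] k
      unfolding right_integral_def QR_eq sR_def mR_def gR_def by simp
    moreover have "((\<lambda>w. (w + b) / k) has_real_derivative 1 / k) (at w)"
      using k by (auto intro!: derivative_eq_intros)
    ultimately have 2: "((\<lambda>w. right_integral ((w + b) / k)) has_real_derivative ((w + b) / k) / (QR w / k\<^sup>2) * (1 / k)) (at w)"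
      by (rule DERIV_chain2)
    have "((w + b) / k) / (QR w / k\<^sup>2) * (1 / k) = (w + b) / QR w" using k by (simp add: power2_eq_square)
    then show ?thesis unfolding \<Psi>_def \<psi>_def using DERIV_cmult[OF DERIV_diff[OF 1 2], of b] by simp
  qed
  \<comment> \<open>The square in the numerator vanishes at no more than one point.\<close>
  have neg: "\<psi> w < 0" if w: "w * (w + b) > 0" "w \<noteq> - (rL * b) / (rL - rR)" for w
  proof -
    have "(rL - rR) * w + rL * b \<noteq> 0"
    proof
      assume A: "(rL - rR) * w + rL * b = 0"
      moreover have "rL * b \<noteq> 0" using rL(2) \<open>offset \<noteq> 0\<close> by (simp add: b_def)
      ultimately have "rL - rR \<noteq> 0" by auto
      then have "w = - (rL * b) / (rL - rR)" using A by (simp add: field_simps)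
      then show False using w(2) by simp
    qed
    then have "b * (w * QR w - (w + b) * QL w) < 0"
      using slope_difference_numerator[OF w(1) H'] unfolding QL_def QR_def
      by (smt (verit) zero_less_power2)
    moreover have "\<psi> w = b * (w * QR w - (w + b) * QL w) / (QL w * QR w)"
      unfolding \<psi>_def using QLp[of w] QRp[of w] by (simp add: diff_frac_eq)
    ultimately show ?thesis using QLp[of w] QRp[of w] by (simp add: divide_neg_pos)
  qed
  have dec: "\<Psi> v < \<Psi> u" if "u < v" "\<And>w. u \<le> w \<Longrightarrow> w \<le> v \<Longrightarrow> w * (w + b) > 0" for u v
    by (rule strict_decreasing_off_one_point[OF that(1) der neg]) (use that in auto)
  have red: "\<Psi> (fL q $ 1) - \<Psi> (fL p $ 1) = b * (left_const + right_const)" if "fixed_loop p q" for p q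
  proof -
    have "(fL p $ 1 + b) / k = fR p $ 1" "(fL q $ 1 + b) / k = fR q $ 1"
      using velocities_on_line[of p] velocities_on_line[of q] that k
      by (auto simp: fixed_loop_def b_def k_def field_simps simp del: vector_add_component)
    then show ?thesis using that unfolding \<Psi>_def fixed_loop_def
      by (simp add: right_diff_distrib[symmetric] del: vector_add_component) 
  qed
  have no: False if pq: "fixed_loop p q" and pq': "fixed_loop p' q'" and less: "fL p $ 1 < fL p' $ 1" for p q p' q'
  proof -
    have "left_integral (fL p $ 1) \<le> left_integral (fL p' $ 1) \<longleftrightarrow> fL p' $ 1 \<le> fL p $ 1"
      "left_integral (fL q $ 1) \<le> left_integral (fL q' $ 1) \<longleftrightarrow> fL q $ 1 \<le> fL q' $ 1"
      using pq pq' left_integral_le_iff unfolding fixed_loop_def by (meson less_imp_le)+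
    then have q: "fL q' $ 1 < fL q $ 1" using pq pq' less unfolding fixed_loop_def by linarith
    have sg: "fL p' $ 1 < 0" "fL p' $ 1 + b < 0" "fL q' $ 1 > 0" "fL q' $ 1 + b > 0"
      using pq' velocities_on_line[of p'] velocities_on_line[of q'] ratio_pos
      unfolding fixed_loop_def b_def by (metis mult_pos_neg mult_pos_pos)+
    have "\<Psi> (fL q $ 1) < \<Psi> (fL q' $ 1)" using q sg by (intro dec) (auto intro!: mult_pos_pos)
    moreover have "\<Psi> (fL p' $ 1) < \<Psi> (fL p $ 1)" using less sg by (intro dec) (auto intro!: mult_neg_neg)
    ultimately show False using red[OF pq] red[OF pq'] by linarith
  qed
  have "fL p $ 1 = fL p' $ 1" using no[OF pq pq'] no[OF pq' pq] by (meson linorder_neqE_linordered_idom)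
  then show ?thesis using eq_on_line pq pq' unfolding fixed_loop_def by blast
qed

lemma crossing_periodic_orbits_eq:
  assumes b: "offset \<noteq> 0"
    and H: "Delta (trace AL) (trace AR) (det AL) (det AR) (forcing AL bL) (ratio * forcing AR bR) offset \<le> 0"
    and "crossing_periodic_orbit fL fR \<Gamma>" "crossing_periodic_orbit fL fR \<Gamma>'"
  shows "\<Gamma> = \<Gamma>'"
proof -
  obtain x y where xy: "crossing_motion x" "\<Gamma> = range x" "crossing_motion y" "\<Gamma>' = range y"
    using assms(3,4) unfolding crossing_periodic_orbit_iff by blast
  obtain p q where p: "p \<in> range x" "fixed_loop p q" using crossing_motion_fixed_loop[OF xy(1)] .
  obtain p' q' where p': "p' \<in> range y" "fixed_loop p' q'" using crossing_motion_fixed_loop[OF xy(3)] .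
  have "p = p'" using fixed_loop_unique[OF b H p(2) p'(2)] .
  then show ?thesis using crossing_orbits_meeting_eq[OF xy(1,3)] p(1) p'(1) xy(2,4) by blast
qed

end

section \<open>Periodic extensions that solve the Filippov inclusion\<close>

lemma lipschitz_imp_absolutely_continuous_on:
  assumes lip: "\<And>a b. a \<le> b \<Longrightarrow> norm (x b - x a) \<le> B * (b - a)"
  shows "absolutely_continuous_on S x"
  unfolding absolutely_continuous_on_def
proof (intro allI impI)
  fix e :: real assume e: "e > 0"
  have "norm (x 1 - x 0) \<le> B" using lip[of 0 1] by simp
  then have B: "B \<ge> 0" using norm_ge_zero order_trans by blast
  have "(\<Sum>i<n. norm (x (b i) - x (a i))) < e"
    if "\<forall>i<n. a i \<le> b i" "(\<Sum>i<n. b i - a i) < e / (B + 1)" for n :: nat and a b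
  proof -
    have "(\<Sum>i<n. norm (x (b i) - x (a i))) \<le> (\<Sum>i<n. B * (b i - a i))"
      using that by (intro sum_mono lip) auto
    also have "\<dots> = B * (\<Sum>i<n. b i - a i)" by (rule sum_distrib_left[symmetric])
    also have "\<dots> \<le> B * (e / (B + 1))" using that B by (intro mult_left_mono) auto
    also have "\<dots> < e" using B e by (simp add: field_simps)
    finally show ?thesis .
  qed
  then show "\<exists>\<delta>>0. \<forall>n a b. (\<forall>i<(n::nat). a i \<le> b i \<and> {a i..b i} \<subseteq> S) \<and>
        disjoint_family_on (\<lambda>i. {a i<..<b i}) {..<n} \<and> (\<Sum>i<n. b i - a i) < \<delta> \<longrightarrow>
        (\<Sum>i<n. norm (x (b i) - x (a i))) < e"
    using e B by (intro exI[of _ "e / (B + 1)"]) auto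
qed

lemma increment_le_of_derivative_bound:
  fixes x :: "real \<Rightarrow> 'a::banach"
  assumes cont: "continuous_on {a..b} x" and ab: "a \<le> b" and fin: "finite E" and B: "B \<ge> 0"
    and der: "\<And>t. t \<in> {a<..<b} - E \<Longrightarrow> (x has_vector_derivative v t) (at t)"
    and bd: "\<And>t. t \<in> {a<..<b} - E \<Longrightarrow> norm (v t) \<le> B"
  shows "norm (x b - x a) \<le> B * (b - a)"
proof -
  have "(v has_integral (x b - x a)) {a..b}"
    by (rule fundamental_theorem_of_calculus_interior_strong[OF fin ab der cont])
  then have "norm (x b - x a) \<le> B * measure lborel {a..b}"
    by (rule has_integral_bound_real[OF B, where S = "insert a (insert b E)", rotated]) (use fin bd in auto)
  then show ?thesis using ab by simp
qed

definition periodic_extension :: "real \<Rightarrow> (real \<Rightarrow> 'a) \<Rightarrow> real \<Rightarrow> 'a" where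
  "periodic_extension T Y t = Y (t - T * of_int \<lfloor>t / T\<rfloor>)"

lemma period_index:
  fixes T t :: real
  assumes "T > 0"
  shows "T * of_int \<lfloor>t / T\<rfloor> \<le> t" "t < T * of_int \<lfloor>t / T\<rfloor> + T"
proof -
  have "t / T < of_int \<lfloor>t / T\<rfloor> + 1" by linarith
  then show "t < T * of_int \<lfloor>t / T\<rfloor> + T" using assms by (simp add: field_simps)
  have "T * of_int \<lfloor>t / T\<rfloor> \<le> T * (t / T)" using assms by (intro mult_left_mono) auto
  then show "T * of_int \<lfloor>t / T\<rfloor> \<le> t" using assms by simp
qed

lemma periodic_extension_eq:
  assumes T: "T > 0" and Y: "Y 0 = Y T" and t: "T * of_int n \<le> t" "t \<le> T * of_int n + T"
  shows "periodic_extension T Y t = Y (t - T * of_int n)"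
proof (cases "t = T * of_int n + T")
  case True
  then have "t / T = of_int (n + 1)" using T by (simp add: field_simps)
  then have "\<lfloor>t / T\<rfloor> = n + 1" by simp
  then show ?thesis using True Y by (simp add: periodic_extension_def distrib_left)
next
  case False
  then have "\<lfloor>t / T\<rfloor> = n" using t T by (intro floor_unique) (simp_all add: field_simps)
  then show ?thesis by (simp add: periodic_extension_def)
qed

lemma periodic_extension_periodic:
  assumes "T > 0" shows "periodic_extension T Y (t + T) = periodic_extension T Y t"
proof -
  have "(t + T) / T = t / T + 1" using assms by (simp add: add_divide_distrib)
  then have "\<lfloor>(t + T) / T\<rfloor> = \<lfloor>t / T\<rfloor> + 1" by simp
  then show ?thesis by (simp add: periodic_extension_def distrib_left)
qed

lemma periodic_extension_range:
  assumes T: "T > 0" and Y: "Y 0 = Y T"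
  shows "range (periodic_extension T Y) = Y ` {0..T}"
proof
  show "range (periodic_extension T Y) \<subseteq> Y ` {0..T}"
  proof
    fix y assume "y \<in> range (periodic_extension T Y)"
    then obtain t where "y = Y (t - T * of_int \<lfloor>t / T\<rfloor>)" by (auto simp: periodic_extension_def)
    moreover have "t - T * of_int \<lfloor>t / T\<rfloor> \<in> {0..T}" using period_index[OF T, of t] by auto
    ultimately show "y \<in> Y ` {0..T}" by blast
  qed
  show "Y ` {0..T} \<subseteq> range (periodic_extension T Y)"
  proof
    fix y assume "y \<in> Y ` {0..T}"
    then obtain t where t: "y = Y t" "0 \<le> t" "t \<le> T" by auto
    then have "y = periodic_extension T Y t" using periodic_extension_eq[OF T Y, of 0 t] by simp
    then show "y \<in> range (periodic_extension T Y)" by blast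
  qed
qed

lemma periodic_extension_has_derivative:
  assumes T: "T > 0" and Y: "Y 0 = Y T" and t: "T * of_int n < t" "t < T * of_int n + T"
    and der: "(Y has_vector_derivative v) (at (t - T * of_int n))"
  shows "(periodic_extension T Y has_vector_derivative v) (at t)"
proof -
  have "((\<lambda>t. t - T * of_int n) has_vector_derivative 1) (at t)"
    by (auto intro!: derivative_eq_intros)
  from vector_diff_chain_at[OF this der]
  have "((\<lambda>t. Y (t - T * of_int n)) has_vector_derivative v) (at t)" by (simp add: o_def)
  then show ?thesis
    by (rule has_vector_derivative_transform_within_open[where S = "{T * of_int n<..<T * of_int n + T}"])
      (use t periodic_extension_eq[OF T Y, of n] in auto)
qed

text \<open>The multiples of \<open>T\<close> are covered by gluing two consecutive periods.\<close>
lemma periodic_extension_continuous: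
  assumes T: "T > 0" and Y: "Y 0 = Y T" and cont: "continuous_on {0..T} Y"
  shows "continuous_on S (periodic_extension T Y)"
proof -
  have piece: "continuous_on {T * of_int n..T * of_int n + T} (periodic_extension T Y)" for n
  proof -
    have "continuous_on {T * of_int n..T * of_int n + T} (\<lambda>t. Y (t - T * of_int n))"
      by (rule continuous_on_compose2[OF cont]) (auto intro!: continuous_intros)
    then show ?thesis
      by (rule continuous_on_eq) (use periodic_extension_eq[OF T Y, of n] in auto)
  qed
  have "isCont (periodic_extension T Y) t" for t
  proof -
    define n where "n = \<lfloor>t / T\<rfloor>"
    have n: "T * of_int n \<le> t" "t < T * of_int n + T" using period_index[OF T, of t] by (auto simp: n_def)
    have "continuous_on ({T * of_int (n - 1)..T * of_int (n - 1) + T} \<union> {T * of_int n..T * of_int n + T}) (periodic_extension T Y)"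
      by (intro continuous_on_closed_Un piece) auto
    then have "continuous_on {T * of_int n - T<..<T * of_int n + T} (periodic_extension T Y)"
      by (rule continuous_on_subset) (auto simp: right_diff_distrib)
    then show ?thesis using n T by (simp add: continuous_on_eq_continuous_at)
  qed
  then show ?thesis by (simp add: continuous_at_imp_continuous_on)
qed

lemma finite_multiples_in_interval:
  fixes T a b :: real
  assumes T: "T > 0"
  shows "finite {t \<in> {a..b}. \<exists>n::int. t = T * of_int n + c}"
proof (rule finite_subset)
  show "{t \<in> {a..b}. \<exists>n::int. t = T * of_int n + c} \<subseteq> (\<lambda>n::int. T * of_int n + c) ` {\<lfloor>(a - c) / T\<rfloor>..\<lceil>(b - c) / T\<rceil>}"
  proof clarify
    fix n :: int assume n: "T * of_int n + c \<in> {a..b}"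
    have "(a - c) / T \<le> of_int n" "of_int n \<le> (b - c) / T" using n T by (auto simp: field_simps)
    then have "n \<in> {\<lfloor>(a - c) / T\<rfloor>..\<lceil>(b - c) / T\<rceil>}" by (auto simp: floor_le_iff le_ceiling_iff)
    then show "T * of_int n + c \<in> (\<lambda>n::int. T * of_int n + c) ` {\<lfloor>(a - c) / T\<rfloor>..\<lceil>(b - c) / T\<rceil>}" by blast
  qed
qed auto

text \<open>The switching times \<open>n T\<close> and \<open>n T + \<tau>\<close> are countably many and locally finite, so away from
  them the bounded derivative gives a Lipschitz, hence absolutely continuous, function.\<close>
lemma periodic_extension_filippov_solution:
  assumes \<tau>: "0 < \<tau>" "\<tau> < T" and Y: "Y 0 = Y T" and cont: "continuous_on {0..T} Y"
    and der: "\<And>t. t \<in> {0<..<T} - {\<tau>} \<Longrightarrow> (Y has_vector_derivative v t) (at t)"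
    and fil: "\<And>t. t \<in> {0<..<T} - {\<tau>} \<Longrightarrow> v t \<in> filippov_set fL fR (Y t)"
    and bd: "\<And>t. t \<in> {0<..<T} - {\<tau>} \<Longrightarrow> norm (v t) \<le> B"
  shows "filippov_solution fL fR (periodic_extension T Y)"
proof -
  define X where "X = periodic_extension T Y"
  define w where "w = periodic_extension T v"
  define E where "E = {t. \<exists>n::int. t = T * of_int n + 0} \<union> {t. \<exists>n::int. t = T * of_int n + \<tau>}"
  have T: "T > 0" using \<tau> by simp
  have B: "B \<ge> 0"
  proof -
    have "\<tau> / 2 \<in> {0<..<T} - {\<tau>}" using \<tau> by auto
    then show ?thesis using bd norm_ge_zero order_trans by blast
  qed
  have good: "(X has_vector_derivative w t) (at t) \<and> w t \<in> filippov_set fL fR (X t) \<and> norm (w t) \<le> B" if "t \<notin> E" for t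
  proof -
    define n where "n = \<lfloor>t / T\<rfloor>"
    have n: "T * of_int n \<le> t" "t < T * of_int n + T" using period_index[OF T, of t] by (auto simp: n_def)
    have "t \<noteq> T * of_int n" "t \<noteq> T * of_int n + \<tau>" using that by (auto simp: E_def)
    then have t: "t - T * of_int n \<in> {0<..<T} - {\<tau>}" "T * of_int n < t" using n by auto
    have "X t = Y (t - T * of_int n)" "w t = v (t - T * of_int n)"
      by (simp_all add: X_def w_def periodic_extension_def n_def)
    then show ?thesis
      using periodic_extension_has_derivative[OF T Y t(2) n(2) der[OF t(1)]] fil[OF t(1)] bd[OF t(1)]
      by (simp add: X_def)
  qed
  have finE: "finite (E \<inter> {a..b})" for a b
  proof -
    have "E \<inter> {a..b} \<subseteq> {t \<in> {a..b}. \<exists>n::int. t = T * of_int n + 0} \<union> {t \<in> {a..b}. \<exists>n::int. t = T * of_int n + \<tau>}"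
      by (auto simp: E_def)
    then show ?thesis using finite_multiples_in_interval[OF T] by (meson finite_Un finite_subset)
  qed
  have "norm (X b - X a) \<le> B * (b - a)" if "a \<le> b" for a b
    by (rule increment_le_of_derivative_bound[OF _ that finE[of a b] B, where v = w])
      (use good periodic_extension_continuous[OF T Y cont] in \<open>auto simp: X_def\<close>)
  then have "absolutely_continuous_on S X" for S by (rule lipschitz_imp_absolutely_continuous_on)
  moreover have "AE t in lborel. \<exists>v\<in>filippov_set fL fR (X t). (X has_vector_derivative v) (at t)"
  proof (rule AE_I')
    have "E = range (\<lambda>n::int. T * of_int n + 0) \<union> range (\<lambda>n::int. T * of_int n + \<tau>)" by (auto simp: E_def)
    then have "countable E" by (simp del: add_0_right)
    then show "E \<in> null_sets lborel" by (rule countable_imp_null_set_lborel)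
    show "{t \<in> space lborel. \<not> (\<exists>v\<in>filippov_set fL fR (X t). (X has_vector_derivative v) (at t))} \<subseteq> E"
      using good by blast
  qed
  ultimately show ?thesis unfolding filippov_solution_def X_def[symmetric] by blast
qed

section \<open>The flow of a focus\<close>

text \<open>The inverse of the complex coordinate \<open>focus_coord\<close>, written out so that continuity and
  differentiation are those of an affine map.\<close>
definition unfocus :: "real^2^2 \<Rightarrow> real^2 \<Rightarrow> complex \<Rightarrow> real^2" where
  "unfocus A c z = Re z *\<^sub>R vector [1, (focus_re A - A $ 1 $ 1) / A $ 1 $ 2]
     + Im z *\<^sub>R vector [0, - focus_im A / A $ 1 $ 2]
     + vector [forcing A c / det A, (- A $ 1 $ 1 * (forcing A c / det A) - c $ 1) / A $ 1 $ 2]"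

definition focus_flow :: "real^2^2 \<Rightarrow> real^2 \<Rightarrow> real \<Rightarrow> real^2 \<Rightarrow> real^2" where
  "focus_flow A c t p = unfocus A c (exp (focus_eigenvalue A * of_real t) * focus_coord A c p)"

lemma unfocus_fst: "unfocus A c z $ 1 = Re z + forcing A c / det A"
  by (simp add: unfocus_def)

lemma unfocus_velocity:
  assumes "A $ 1 $ 2 \<noteq> 0"
  shows "(A *v unfocus A c z + c) $ 1 = Re (focus_eigenvalue A * z)"
  unfolding field_fst unfocus_def focus_eigenvalue_def using assms by (simp add: field_simps)

lemma focus_coord_unfocus:
  assumes "A $ 1 $ 2 \<noteq> 0" "(trace A)\<^sup>2 - 4 * det A < 0"
  shows "focus_coord A c (unfocus A c z) = z"
proof -
  have "(focus_re A * Re z - Re (focus_eigenvalue A * z)) / focus_im A = Im z"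
    using focus_im_pos[OF assms(2)] by (simp add: focus_eigenvalue_def)
  then show ?thesis
    unfolding focus_coord_def unfocus_velocity[OF assms(1)] unfocus_fst by (simp add: complex_eq_iff)
qed

lemma unfocus_focus_coord:
  assumes "A $ 1 $ 2 \<noteq> 0" "(trace A)\<^sup>2 - 4 * det A < 0"
  shows "unfocus A c (focus_coord A c p) = p"
  by (rule focus_coord_inj[OF assms]) (rule focus_coord_unfocus[OF assms])

lemma focus_flow_0:
  assumes "A $ 1 $ 2 \<noteq> 0" "(trace A)\<^sup>2 - 4 * det A < 0"
  shows "focus_flow A c 0 p = p"
  by (simp add: focus_flow_def unfocus_focus_coord[OF assms])

lemma continuous_on_unfocus [continuous_intros]:
  "continuous_on S g \<Longrightarrow> continuous_on S (\<lambda>x. unfocus A c (g x))"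
  unfolding unfocus_def by (intro continuous_intros)

lemma focus_flow_has_derivative:
  assumes A: "A $ 1 $ 2 \<noteq> 0" "(trace A)\<^sup>2 - 4 * det A < 0"
  shows "((\<lambda>t. focus_flow A c t p) has_vector_derivative A *v focus_flow A c t p + c) (at t)"
proof -
  define l where "l = focus_eigenvalue A"
  define z where "z = (\<lambda>t::real. exp (l * of_real t) * focus_coord A c p)"
  have "((\<lambda>t. exp (l * of_real t)) has_vector_derivative l * exp (l * of_real t)) (at t)"
    by (rule has_vector_derivative_real_field) (auto intro!: derivative_eq_intros)
  from has_vector_derivative_mult_left[OF this, of "focus_coord A c p"]
  have dz: "(z has_vector_derivative l * z t) (at t)" by (simp add: z_def mult.assoc)
  define f where "f = forcing A c / det A"
  have D: "det A > 0" by (rule det_pos_of_focus[OF A(2)])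
  have lin: "((\<lambda>t. unfocus A c (z t)) has_vector_derivative
      unfocus A c (l * z t) - unfocus A c 0) (at t)"
  proof -
    have "((\<lambda>t. Re (z t) *\<^sub>R u + Im (z t) *\<^sub>R w + d) has_vector_derivative Re (l * z t) *\<^sub>R u + Im (l * z t) *\<^sub>R w) (at t)"
      for u w d :: "real^2"
    proof -
      have R: "((\<lambda>t. Re (z t) *\<^sub>R u) has_vector_derivative Re (l * z t) *\<^sub>R u) (at t)"
        by (rule bounded_linear.has_vector_derivative[OF bounded_linear_scaleR_left bounded_linear.has_vector_derivative[OF bounded_linear_Re dz]])
      have I: "((\<lambda>t. Im (z t) *\<^sub>R w) has_vector_derivative Im (l * z t) *\<^sub>R w) (at t)"
        by (rule bounded_linear.has_vector_derivative[OF bounded_linear_scaleR_left bounded_linear.has_vector_derivative[OF bounded_linear_Im dz]])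
      show ?thesis
        using has_vector_derivative_add[OF has_vector_derivative_add[OF R I] has_vector_derivative_const] by simp
    qed
    then show ?thesis unfolding unfocus_def by simp
  qed
  moreover have "unfocus A c (l * z t) - unfocus A c 0 = A *v unfocus A c (z t) + c"
  proof -
    define q where "q = unfocus A c (z t)"
    have zq: "z t = focus_coord A c q" unfolding q_def by (rule focus_coord_unfocus[OF A, symmetric])
    have v: "Re (l * z t) = (A *v q + c) $ 1" unfolding zq l_def by (rule focus_coord_velocity[OF A(2), symmetric])
    have 1: "(unfocus A c (l * z t) - unfocus A c 0) $ 1 = (A *v q + c) $ 1"
      unfolding vector_minus_component unfocus_fst v by simp
    have "Re (l * (l * z t)) = trace A * Re (l * z t) - det A * Re (z t)"
    proof -
      have "l * (l * z t) = of_real (trace A) * (l * z t) - of_real (det A) * z t"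
        unfolding l_def focus_eigenvalue_def det_eq_focus[OF A(2)]
        by (simp add: complex_eq_iff focus_re_def power2_eq_square algebra_simps)
      then show ?thesis by simp
    qed
    also have "\<dots> = trace A * (A *v q + c) $ 1 - det A * (q $ 1 - f)"
      unfolding v by (simp add: zq focus_coord_def f_def)
    also have "\<dots> = A $ 1 $ 1 * (A *v q + c) $ 1 + A $ 1 $ 2 * (A *v q + c) $ 2"
    proof -
      have "f * det A = A $ 1 $ 2 * c $ 2 - A $ 2 $ 2 * c $ 1" using D by (simp add: f_def forcing_def)
      then show ?thesis unfolding field_fst field_snd trace_2 det_2 by algebra
    qed
    finally have 2: "Re (l * (l * z t)) = A $ 1 $ 1 * (A *v q + c) $ 1 + A $ 1 $ 2 * (A *v q + c) $ 2" .
    have "A $ 1 $ 1 * (unfocus A c (l * z t) - unfocus A c 0) $ 1 + A $ 1 $ 2 * (unfocus A c (l * z t) - unfocus A c 0) $ 2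
        = (A *v unfocus A c (l * z t) + c) $ 1 - (A *v unfocus A c 0 + c) $ 1"
      unfolding field_fst vector_minus_component by (simp add: right_diff_distrib)
    also have "\<dots> = Re (l * (l * z t))" unfolding unfocus_velocity[OF A(1)] l_def by simp
    finally have "(unfocus A c (l * z t) - unfocus A c 0) $ 2 = (A *v q + c) $ 2"
      using A(1) unfolding 1 2 by simp
    then show ?thesis using 1 unfolding q_def by (simp only: vec_eq_iff forall_2)
  qed
  ultimately show ?thesis unfolding focus_flow_def z_def l_def by simp
qed

section \<open>The mirror-symmetric case\<close>

text \<open>The tube lemma as a statement about small perturbations of a parameter.\<close>
lemma eventually_compact_slice:
  fixes H :: "real \<Rightarrow> real \<Rightarrow> 'a::topological_space"
  assumes K: "compact K" and N: "open N" "t0 \<in> N" and H: "continuous_on (N \<times> UNIV) (\<lambda>x. H (fst x) (snd x))"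
    and W: "open W" "\<And>s. s \<in> K \<Longrightarrow> H t0 s \<in> W"
  shows "\<forall>\<^sub>F t in nhds t0. \<forall>s\<in>K. H t s \<in> W"
proof -
  define V where "V = (N \<times> UNIV) \<inter> (\<lambda>x. H (fst x) (snd x)) -` W"
  have "open V" unfolding V_def using N by (intro continuous_open_preimage[OF H _ W(1)] open_Times) auto
  then have V: "openin (prod_topology euclidean euclidean) V"
    by (simp add: euclidean_product_topology)
  have C: "compactin euclidean K" using K by simp
  have sub: "{t0} \<times> K \<subseteq> V" using N W by (auto simp: V_def)
  obtain A B where AB: "open A" "t0 \<in> A" "K \<subseteq> B" "A \<times> B \<subseteq> V"
    using tube_lemma_right[OF V C _ sub] by auto
  then have "\<forall>t\<in>A. \<forall>s\<in>K. H t s \<in> W" by (force simp: V_def)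
  then show ?thesis using AB(1,2) unfolding eventually_nhds by blast
qed

text \<open>In these relations the right system, rescaled by \<open>ratio\<close>, is obtained from the left one by
  \<open>x\<^sub>1 \<mapsto> - x\<^sub>1 / m\<close> and \<open>t \<mapsto> - t / m\<close>.\<close>
locale mirrored_foci = two_forced_foci +
  fixes m :: real
  assumes m_pos: "m > 0" and offset_0: "offset = 0"
    and mirror_forcing: "ratio * forcing AR bR = - m * forcing AL bL"
    and mirror_det: "det AR = m\<^sup>2 * det AL" and mirror_trace: "trace AR = - m * trace AL"
begin

text \<open>The linear map that fixes the line, exchanges the sides and carries the left field to the right
  field up to the factor \<open>- m\<close>. The lower left entry is forced by the first component of that
  relation.\<close>
definition mirror :: "real^2 \<Rightarrow> real^2" where
  "mirror p = vector [vector [- 1 / (m * ratio), 0], vector [(AL $ 1 $ 1 + AR $ 1 $ 1 / m) / AL $ 1 $ 2, 1]] *v p"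

lemma mirror_components:
  "mirror p $ 1 = - 1 / (m * ratio) * p $ 1"
  "mirror p $ 2 = (AL $ 1 $ 1 + AR $ 1 $ 1 / m) / AL $ 1 $ 2 * p $ 1 + p $ 2"
  by (simp_all add: mirror_def matrix_vector_mult_def sum_2)

lemma bounded_linear_mirror: "bounded_linear mirror"
  unfolding mirror_def by simp

lemma mirror_field: "fR (mirror p) = - m *\<^sub>R mirror (fL p)"
proof -
  define k where "k = ratio"
  define n where "n = 1 / (m * k)"
  define g where "g = (AL $ 1 $ 1 + AR $ 1 $ 1 / m) / AL $ 1 $ 2"
  have nz: "AL $ 1 $ 2 \<noteq> 0" "AR $ 1 $ 2 \<noteq> 0" "m \<noteq> 0" "k \<noteq> 0"
    using a12 m_pos ratio_pos by (auto simp: k_def)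
  have e1: "n * (m * k) = 1" using nz by (simp add: n_def)
  have e2: "k * AR $ 1 $ 2 = AL $ 1 $ 2" using nz by (simp add: k_def ratio_def)
  have e3: "m * (g * AL $ 1 $ 2) = m * AL $ 1 $ 1 + AR $ 1 $ 1" using nz by (simp add: g_def distrib_left)
  have e4: "k * bR $ 1 = bL $ 1" using offset_0 by (simp add: offset_def k_def)
  have e5: "AR $ 1 $ 1 + AR $ 2 $ 2 = - m * (AL $ 1 $ 1 + AL $ 2 $ 2)" using mirror_trace by (simp add: trace_2)
  have e6: "AR $ 1 $ 1 * AR $ 2 $ 2 - AR $ 1 $ 2 * AR $ 2 $ 1 = m * m * (AL $ 1 $ 1 * AL $ 2 $ 2 - AL $ 1 $ 2 * AL $ 2 $ 1)"
    using mirror_det by (simp add: det_2 power2_eq_square)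
  have e7: "k * (AR $ 1 $ 2 * bR $ 2 - AR $ 2 $ 2 * bR $ 1) = - m * (AL $ 1 $ 2 * bL $ 2 - AL $ 2 $ 2 * bL $ 1)"
    using mirror_forcing by (simp add: forcing_def k_def)
  have M: "mirror p $ 1 = - n * p $ 1" "mirror p $ 2 = g * p $ 1 + p $ 2" for p
    by (simp_all add: mirror_components n_def g_def k_def)
  have "m * k * (fR (mirror p) $ 1) = m * k * (- m * mirror (fL p) $ 1)"
    unfolding M field_fst using e1 e2 e3 e4 by algebra
  then have 1: "fR (mirror p) $ 1 = - m * mirror (fL p) $ 1"
    using nz by (simp only: mult_cancel_left mult_eq_0_iff simp_thms)
  have "m * AL $ 1 $ 2 * (fR (mirror p) $ 2) = m * AL $ 1 $ 2 * (- m * mirror (fL p) $ 2)"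
    unfolding M field_fst field_snd using e1 e2 e3 e4 e5 e6 e7 by algebra
  then have 2: "fR (mirror p) $ 2 = - m * mirror (fL p) $ 2"
    using nz by (simp only: mult_cancel_left mult_eq_0_iff simp_thms)
  show ?thesis unfolding vec_eq_iff forall_2 vector_scaleR_component real_scaleR_def using 1 2 by blast
qed

lemma mirror_fst_sign:
  "mirror p $ 1 = 0 \<longleftrightarrow> p $ 1 = 0" "mirror p $ 1 > 0 \<longleftrightarrow> p $ 1 < 0"
proof -
  have "m * ratio > 0" using m_pos ratio_pos by simp
  moreover have "(- 1 / k * y = 0 \<longleftrightarrow> y = 0) \<and> (- 1 / k * y > 0 \<longleftrightarrow> y < 0)" if "k > 0" for k y :: real
    using that by (auto simp: zero_less_divide_iff divide_less_0_iff)
  ultimately show "mirror p $ 1 = 0 \<longleftrightarrow> p $ 1 = 0" "mirror p $ 1 > 0 \<longleftrightarrow> p $ 1 < 0"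
    unfolding mirror_components by blast+
qed

lemma mirror_fixes_line: "p $ 1 = 0 \<Longrightarrow> mirror p = p"
  by (simp add: vec_eq_iff forall_2 mirror_components)

abbreviation "flow \<equiv> focus_flow AL bL"

lemma AL_12: "AL $ 1 $ 2 \<noteq> 0"
  using a12 by auto

lemmas flow_has_derivative = focus_flow_has_derivative[OF AL_12 FL, of bL]
lemmas flow_0 = focus_flow_0[OF AL_12 FL, of bL]

lemma continuous_on_flow: "continuous_on S (\<lambda>t. flow t p)"
  using has_vector_derivative_continuous[OF flow_has_derivative] by (simp add: continuous_at_imp_continuous_on)

text \<open>The left arc from \<open>p\<close> of duration \<open>\<tau>\<close>, which its mirror image closes up to a periodic orbit.\<close>
definition left_loop :: "real \<Rightarrow> real^2 \<Rightarrow> bool" where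
  "left_loop \<tau> p \<longleftrightarrow> \<tau> > 0 \<and> p $ 1 = 0 \<and> fL p $ 1 < 0 \<and> flow \<tau> p $ 1 = 0 \<and> fL (flow \<tau> p) $ 1 > 0 \<and>
     (\<forall>t\<in>{0<..<\<tau>}. flow t p $ 1 < 0)"

definition loop_orbit :: "real \<Rightarrow> real^2 \<Rightarrow> (real^2) set" where
  "loop_orbit \<tau> p = (\<lambda>t. flow t p) ` {0..\<tau>} \<union> (\<lambda>t. mirror (flow t p)) ` {0..\<tau>}"

lemma left_loop_meets_line:
  assumes "left_loop \<tau> p" "t \<in> {0..\<tau>}" "flow t p $ 1 = 0"
  shows "t = 0 \<or> t = \<tau>"
  using assms unfolding left_loop_def by (metis atLeastAtMost_iff greaterThanLessThan_iff less_irrefl order_le_imp_less_or_eq)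

text \<open>Run through the left arc, then through its mirror image backwards and \<open>m\<close> times as fast, and
  repeat. The two pieces fit together because the mirror fixes the line.\<close>
lemma loop_orbit_crossing_periodic:
  assumes loop: "left_loop \<tau> p"
  shows "crossing_periodic_orbit fL fR (loop_orbit \<tau> p)"
proof -
  have \<tau>: "\<tau> > 0" and p: "p $ 1 = 0" "fL p $ 1 < 0" and q: "flow \<tau> p $ 1 = 0" "fL (flow \<tau> p) $ 1 > 0"
    and neg: "\<And>t. 0 < t \<Longrightarrow> t < \<tau> \<Longrightarrow> flow t p $ 1 < 0"
    using loop unfolding left_loop_def by auto
  define T where "T = \<tau> + \<tau> / m"
  have T: "\<tau> < T" "T > 0" using \<tau> m_pos by (simp_all add: T_def add_pos_pos)
  \<comment> \<open>Position on the left arc while its mirror image is traversed.\<close>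
  define r where "r = (\<lambda>t. \<tau> - m * (t - \<tau>))"
  have r: "r \<tau> = \<tau>" "r T = 0" using m_pos by (simp_all add: r_def T_def)
  have r_range: "0 < r t" "r t < \<tau>" if "\<tau> < t" "t < T" for t
  proof -
    have "m * (t - \<tau>) < m * (T - \<tau>)" using that m_pos by simp
    then show "0 < r t" using r(2) by (simp add: r_def)
    show "r t < \<tau>" using that m_pos by (simp add: r_def)
  qed
  define Y where "Y = (\<lambda>t. if t \<le> \<tau> then flow t p else mirror (flow (r t) p))"
  have Y0: "Y 0 = Y T" using \<tau> T p(1) by (simp add: Y_def r flow_0 mirror_fixes_line)
  have Yneg: "Y t $ 1 < 0" if "0 < t" "t < \<tau>" for t using neg that by (simp add: Y_def)
  have Ypos: "Y t $ 1 > 0" if "\<tau> < t" "t < T" for t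
    using neg[OF r_range[OF that]] that by (simp add: Y_def mirror_fst_sign)
  have contY: "continuous_on {0..T} Y"
  proof -
    have "continuous_on S (\<lambda>t. mirror (flow (r t) p))" for S
      unfolding r_def
      by (intro bounded_linear.continuous_on[OF bounded_linear_mirror] continuous_on_compose2[OF continuous_on_flow[of UNIV]] continuous_intros) auto
    then show ?thesis unfolding Y_def
      by (intro continuous_on_cases_le continuous_on_flow) (auto simp: r q mirror_fixes_line)
  qed
  define v where "v = (\<lambda>t. if t < \<tau> then fL (Y t) else fR (Y t))"
  have der: "(Y has_vector_derivative v t) (at t)" if t: "t \<in> {0<..<T} - {\<tau>}" for t
  proof (cases "t < \<tau>")
    case True
    have "(Y has_vector_derivative fL (flow t p)) (at t)"
      by (rule has_vector_derivative_transform_within_open[OF flow_has_derivative, of "{..<\<tau>}"]) (use True in \<open>auto simp: Y_def\<close>)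
    then show ?thesis using True by (simp add: v_def Y_def)
  next
    case False
    then have t': "\<tau> < t" using t by auto
    have "(r has_vector_derivative - m) (at t)"
      unfolding r_def by (auto intro!: derivative_eq_intros simp: has_real_derivative_iff_has_vector_derivative[symmetric])
    from vector_diff_chain_at[OF this flow_has_derivative]
    have "((\<lambda>t. flow (r t) p) has_vector_derivative - m *\<^sub>R fL (flow (r t) p)) (at t)" by (simp add: o_def)
    from bounded_linear.has_vector_derivative[OF bounded_linear_mirror this]
    have "((\<lambda>t. mirror (flow (r t) p)) has_vector_derivative fR (mirror (flow (r t) p))) (at t)"
      unfolding mirror_field by (simp only: linear_cmul[OF bounded_linear.linear[OF bounded_linear_mirror]])
    then have "(Y has_vector_derivative fR (mirror (flow (r t) p))) (at t)"
      by (rule has_vector_derivative_transform_within_open[of _ _ _ "{\<tau><..}"]) (use t' in \<open>auto simp: Y_def\<close>)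
    then show ?thesis using t' by (simp add: v_def Y_def)
  qed
  obtain B where B: "\<And>t. t \<in> {0..T} \<Longrightarrow> norm (fL (Y t)) \<le> B \<and> norm (fR (Y t)) \<le> B"
  proof -
    have "bounded ((\<lambda>t. fL (Y t)) ` {0..T})" "bounded ((\<lambda>t. fR (Y t)) ` {0..T})"
      by (intro compact_imp_bounded compact_continuous_image continuous_on_compose2[OF continuous_on_affine_field contY, of UNIV]; simp)+
    then obtain B1 B2 where "\<And>t. t \<in> {0..T} \<Longrightarrow> norm (fL (Y t)) \<le> B1" "\<And>t. t \<in> {0..T} \<Longrightarrow> norm (fR (Y t)) \<le> B2"
      unfolding bounded_iff by (metis imageI)
    then show ?thesis using that[of "max B1 B2"] by (meson max.coboundedI1 max.coboundedI2)
  qed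
  define X where "X = periodic_extension T Y"
  have sol: "filippov_solution fL fR X"
    unfolding X_def
  proof (rule periodic_extension_filippov_solution[OF \<tau> T(1) Y0 contY der])
    fix t assume t: "t \<in> {0<..<T} - {\<tau>}"
    then show "v t \<in> filippov_set fL fR (Y t)"
      using Yneg[of t] Ypos[of t] by (auto simp: v_def filippov_set_off_line)
    show "norm (v t) \<le> B" using B[of t] t by (auto simp: v_def)
  qed
  have ran: "range X = Y ` {0..T}" unfolding X_def by (rule periodic_extension_range[OF T(2) Y0])
  have orb: "Y ` {0..T} = loop_orbit \<tau> p"
  proof
    show "Y ` {0..T} \<subseteq> loop_orbit \<tau> p"
    proof
      fix y assume "y \<in> Y ` {0..T}"
      then obtain t where t: "y = Y t" "0 \<le> t" "t \<le> T" by auto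
      show "y \<in> loop_orbit \<tau> p"
      proof (cases "t \<le> \<tau>")
        case True
        then show ?thesis using t by (auto simp: Y_def loop_orbit_def)
      next
        case False
        then have "r t \<in> {0..\<tau>}" using r_range[of t] t r(2) \<tau> by (cases "t = T") auto
        then show ?thesis using t False by (auto simp: Y_def loop_orbit_def)
      qed
    qed
    show "loop_orbit \<tau> p \<subseteq> Y ` {0..T}"
    proof
      fix y assume "y \<in> loop_orbit \<tau> p"
      then consider t where "t \<in> {0..\<tau>}" "y = flow t p" | t where "t \<in> {0..\<tau>}" "y = mirror (flow t p)"
        by (auto simp: loop_orbit_def)
      then show "y \<in> Y ` {0..T}"
      proof cases
        case 1
        then have "y = Y t" "t \<in> {0..T}" using T by (auto simp: Y_def)
        then show ?thesis by blast
      next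
        case 2
        define s where "s = \<tau> + (\<tau> - t) / m"
        have s: "r s = t" "\<tau> \<le> s" "s \<le> T" using m_pos 2(1) by (auto simp: s_def r_def T_def divide_right_mono)
        have "y = Y s"
        proof (cases "s = \<tau>")
          case True
          then show ?thesis using 2 s r q by (simp add: Y_def mirror_fixes_line)
        qed (use 2 s in \<open>simp add: Y_def\<close>)
        then show ?thesis using s \<tau> by auto
      qed
    qed
  qed
  have "crossing_motion X"
    unfolding crossing_motion_def
  proof (intro conjI allI impI)
    show "\<exists>T>0. \<forall>t. X (t + T) = X t"
      using T(2) periodic_extension_periodic[OF T(2)] unfolding X_def by blast
    have inX: "\<exists>t'. X t' = Y t" if "t \<in> {0..T}" for t using ran that by (metis imageI imageE)
    obtain t1 where t1: "X t1 = Y (\<tau> / 2)" using inX[of "\<tau> / 2"] \<tau> T by auto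
    show "\<exists>t. X t $ 1 < 0" using t1 Yneg[of "\<tau> / 2"] \<tau> by (intro exI[of _ t1]) simp
    obtain t2 where t2: "X t2 = Y ((\<tau> + T) / 2)" using inX[of "(\<tau> + T) / 2"] \<tau> T by auto
    show "\<exists>t. X t $ 1 > 0" using t2 Ypos[of "(\<tau> + T) / 2"] T by (intro exI[of _ t2]) simp
    fix t assume zero: "X t $ 1 = 0"
    have "X t \<in> loop_orbit \<tau> p" using ran orb by blast
    then obtain s where s: "s \<in> {0..\<tau>}" "X t = flow s p \<or> X t = mirror (flow s p)" by (auto simp: loop_orbit_def)
    then have z: "flow s p $ 1 = 0" using zero mirror_fst_sign(1) by metis
    then have Xt: "X t = flow s p" using s mirror_fixes_line by metis
    have "fL (X t) $ 1 \<noteq> 0"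
      using left_loop_meets_line[OF loop s(1) z] p q Xt by (auto simp: flow_0 simp del: vector_add_component)
    moreover have "ratio * fR (X t) $ 1 = fL (X t) $ 1" using velocities_on_line[OF zero] offset_0 by simp
    moreover have "u * w > 0" if "k * w = u" "u \<noteq> 0" "k > 0" for k u w :: real
    proof -
      have "u * w = k * (w * w)" "w \<noteq> 0" using that by auto
      moreover have "w * w > 0" using \<open>w \<noteq> 0\<close> by (metis not_real_square_gt_zero)
      ultimately show ?thesis using that(3) by (metis mult_pos_pos)
    qed
    ultimately have "fL (X t) $ 1 * fR (X t) $ 1 > 0"
      using ratio_pos by blast
    then show "crossing_point fL fR (X t)" using zero by (simp only: crossing_point_def)
  qed (rule sol)
  then show ?thesis unfolding crossing_periodic_orbit_iff using ran orb by metis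
qed

lemma loop_orbit_start_unique:
  assumes loop: "left_loop \<tau> p" and w: "w \<in> loop_orbit \<tau> p" "w $ 1 = 0" "fL w $ 1 < 0"
  shows "w = p"
proof -
  obtain s where s: "s \<in> {0..\<tau>}" "w = flow s p \<or> w = mirror (flow s p)" using w(1) by (auto simp: loop_orbit_def)
  then have z: "flow s p $ 1 = 0" using w(2) mirror_fst_sign(1) by metis
  then have ws: "w = flow s p" using s mirror_fixes_line by metis
  have "s \<noteq> \<tau>" using ws w(3) loop unfolding left_loop_def by (metis less_asym)
  then have "s = 0" using left_loop_meets_line[OF loop s(1) z] by blast
  then show ?thesis using ws by (simp add: flow_0)
qed

text \<open>The solution, in the complex coordinate, of the condition that a trajectory which starts on the
  line is back on the line after time \<open>\<tau>\<close>. The condition is linear in the imaginary part, with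
  coefficient proportional to \<open>sin (\<omega> \<tau>)\<close>; thus arcs are parametrised explicitly by their duration.\<close>
definition start :: "real \<Rightarrow> complex" where
  "start \<tau> = Complex (- (forcing AL bL / det AL))
     (forcing AL bL / det AL * (exp (- focus_re AL * \<tau>) - cos (focus_im AL * \<tau>)) / sin (focus_im AL * \<tau>))"

text \<open>The trajectories that are on the line at times \<open>0\<close> and \<open>\<tau>\<close>, with time rescaled to \<open>s \<in> [0, 1]\<close> so
  that neighbouring ones are compared on a fixed interval.\<close>
definition family :: "real \<Rightarrow> real \<Rightarrow> real^2" where
  "family \<tau> s = unfocus AL bL (exp (focus_eigenvalue AL * of_real (s * \<tau>)) * start \<tau>)"

lemma family_eq_flow: "family \<tau> s = flow (s * \<tau>) (unfocus AL bL (start \<tau>))"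
  unfolding family_def focus_flow_def focus_coord_unfocus[OF AL_12 FL] by simp

lemma exp_eigenvalue:
  "exp (focus_eigenvalue AL * of_real t) = of_real (exp (focus_re AL * t)) * cis (focus_im AL * t)"
  by (simp add: exp_eq_polar focus_eigenvalue_def)

lemma family_ends_on_line:
  assumes "sin (focus_im AL * \<tau>) \<noteq> 0"
  shows "family \<tau> 0 $ 1 = 0" "family \<tau> 1 $ 1 = 0"
proof -
  show "family \<tau> 0 $ 1 = 0" by (simp add: family_def unfocus_fst start_def)
  define E where "E = exp (focus_re AL * \<tau>)"
  define f where "f = forcing AL bL / det AL"
  have E: "exp (- focus_re AL * \<tau>) = 1 / E" "E > 0" by (simp_all add: E_def exp_minus inverse_eq_divide)
  have flow1: "exp (focus_eigenvalue AL * of_real (1 * \<tau>)) = of_real E * cis (focus_im AL * \<tau>)"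
    by (simp only: exp_eigenvalue E_def mult_1)
  show "family \<tau> 1 $ 1 = 0"
    unfolding family_def unfocus_fst start_def flow1 f_def[symmetric] E(1)
    using assms E(2) by (simp add: field_simps)
qed

text \<open>If \<open>sin (\<omega> \<tau>)\<close> vanished, returning to the line off the focus would force \<open>e\<^bsup>\<sigma>\<tau>\<^esup> cos (\<omega> \<tau>) = 1\<close>,
  hence a return to the same point with the same velocity; but the velocity changes sign.\<close>
lemma left_loop_start:
  assumes loop: "left_loop \<tau> p"
  shows "sin (focus_im AL * \<tau>) \<noteq> 0" "unfocus AL bL (start \<tau>) = p"
proof -
  define f where "f = forcing AL bL / det AL"
  define z where "z = focus_coord AL bL p"
  define E where "E = exp (focus_re AL * \<tau>)"
  have E: "exp (- focus_re AL * \<tau>) = 1 / E" "E > 0" by (simp_all add: E_def exp_minus inverse_eq_divide)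
  have f: "f \<noteq> 0" using aL det_pos_of_focus[OF FL] by (simp add: f_def)
  have pz: "p = unfocus AL bL z" unfolding z_def by (rule unfocus_focus_coord[OF AL_12 FL, symmetric])
  have flow_p: "flow \<tau> p = unfocus AL bL (of_real E * cis (focus_im AL * \<tau>) * z)"
    unfolding focus_flow_def z_def E_def exp_eigenvalue ..
  have re: "Re z = - f" using loop unfolding left_loop_def pz unfocus_fst f_def by simp
  have ret: "E * (- f * cos (focus_im AL * \<tau>) - Im z * sin (focus_im AL * \<tau>)) = - f"
  proof -
    have "Re (of_real E * cis (focus_im AL * \<tau>) * z) + f = 0"
      using loop unfolding left_loop_def flow_p unfocus_fst f_def by blast
    then show ?thesis by (simp add: re algebra_simps)
  qed
  show s: "sin (focus_im AL * \<tau>) \<noteq> 0"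
  proof
    assume s: "sin (focus_im AL * \<tau>) = 0"
    then have "E * cos (focus_im AL * \<tau>) = 1" using ret f by simp
    then have "of_real E * cis (focus_im AL * \<tau>) = 1" using s by (simp add: complex_eq_iff)
    then have "flow \<tau> p = p" unfolding flow_p by (simp add: pz[symmetric])
    then show False using loop unfolding left_loop_def by (metis less_asym)
  qed
  have "Im z = f * (1 / E - cos (focus_im AL * \<tau>)) / sin (focus_im AL * \<tau>)"
    using ret s E(2) by (simp add: field_simps)
  then have "z = start \<tau>" unfolding start_def f_def[symmetric] E(1) using re by (simp add: complex_eq_iff)
  then show "unfocus AL bL (start \<tau>) = p" using pz by simp
qed

lemma continuous_on_family:
  "continuous_on ({\<tau>. sin (focus_im AL * \<tau>) \<noteq> 0} \<times> UNIV) (\<lambda>x. family (fst x) (snd x))"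
  unfolding family_def start_def Complex_eq
  by (intro continuous_intros) auto

text \<open>Near its two ends the arc stays on the left because of the sign of its velocity there, and in
  between by assumption; in this form the property is open in the parameter.\<close>
lemma family_left_loop:
  assumes "t > 0" and s: "sin (focus_im AL * t) \<noteq> 0" and e: "0 < e" "e < 1 / 2"
    and v0: "\<And>s. s \<in> {0..e} \<Longrightarrow> fL (family t s) $ 1 < 0"
    and v1: "\<And>s. s \<in> {1 - e..1} \<Longrightarrow> fL (family t s) $ 1 > 0"
    and mid: "\<And>s. s \<in> {e..1 - e} \<Longrightarrow> family t s $ 1 < 0"
  shows "left_loop t (unfocus AL bL (start t))"
proof -
  define p where "p = unfocus AL bL (start t)"
  have fam: "flow r p = family t (r / t)" for r using \<open>t > 0\<close> by (simp add: family_eq_flow p_def)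
  have p: "p = family t 0" unfolding family_eq_flow by (simp add: p_def flow_0)
  have d: "((\<lambda>r. flow r p $ 1) has_real_derivative fL (flow r p) $ 1) (at r)" for r
    using bounded_linear.has_vector_derivative[OF bounded_linear_vec_nth flow_has_derivative]
    by (simp add: has_real_derivative_iff_has_vector_derivative)
  have c: "continuous_on S (\<lambda>r. flow r p $ 1)" for S by (intro continuous_on_component continuous_on_flow)
  have z: "flow 0 p $ 1 = 0" "flow t p $ 1 = 0"
    using family_ends_on_line[OF s] \<open>t > 0\<close> unfolding fam by simp_all
  have "flow r p $ 1 < 0" if r: "0 < r" "r < t" for r
  proof -
    consider "r / t \<le> e" | "r / t \<ge> 1 - e" | "r / t \<in> {e..1 - e}" by fastforce
    then show ?thesis
    proof cases
      case 1
      have "flow r p $ 1 < flow 0 p $ 1"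
      proof (rule DERIV_neg_imp_decreasing_open[OF r(1) _ c])
        fix x assume x: "0 < x" "x < r"
        then have "x / t \<in> {0..e}" using 1 \<open>t > 0\<close> divide_right_mono[of x r t] by auto
        then show "\<exists>y. ((\<lambda>r. flow r p $ 1) has_real_derivative y) (at x) \<and> y < 0"
          using d[of x] v0[of "x / t"] unfolding fam by blast
      qed
      then show ?thesis using z by simp
    next
      case 2
      have "flow r p $ 1 < flow t p $ 1"
      proof (rule DERIV_pos_imp_increasing_open[OF r(2) _ c])
        fix x assume x: "r < x" "x < t"
        then have "x / t \<in> {1 - e..1}" using 2 \<open>t > 0\<close> divide_right_mono[of r x t] by auto
        then show "\<exists>y. ((\<lambda>r. flow r p $ 1) has_real_derivative y) (at x) \<and> 0 < y"
          using d[of x] v1[of "x / t"] unfolding fam by blast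
      qed
      then show ?thesis using z by simp
    next
      case 3
      then show ?thesis using mid unfolding fam by blast
    qed
  qed
  moreover have "fL p $ 1 < 0" unfolding p using v0[of 0] e by simp
  moreover have "fL (flow t p) $ 1 > 0" unfolding fam using v1[of 1] e \<open>t > 0\<close> by simp
  ultimately show ?thesis unfolding left_loop_def p_def[symmetric]
    using z \<open>t > 0\<close> by (simp add: flow_0)
qed

lemma eventually_nearby_loop:
  assumes loop: "left_loop \<tau> p" and U: "open U" "loop_orbit \<tau> p \<subseteq> U"
  shows "\<forall>\<^sub>F t in nhds \<tau>. left_loop t (unfocus AL bL (start t)) \<and> loop_orbit t (unfocus AL bL (start t)) \<subseteq> U"
proof -
  define N where "N = {t. sin (focus_im AL * t) \<noteq> 0}"
  have N: "open N" "\<tau> \<in> N"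
    unfolding N_def using left_loop_start(1)[OF loop]
    by (auto intro!: open_Collect_neq continuous_intros)
  have \<tau>: "\<tau> > 0" using loop by (simp add: left_loop_def)
  have fam: "family \<tau> s = flow (s * \<tau>) p" for s
    unfolding family_eq_flow left_loop_start(2)[OF loop] ..
  have cF: "continuous_on (N \<times> UNIV) (\<lambda>x. family (fst x) (snd x))"
    unfolding N_def by (rule continuous_on_family)
  have cV: "continuous_on (N \<times> UNIV) (\<lambda>x. fL (family (fst x) (snd x)) $ 1)"
    by (intro continuous_on_component continuous_on_compose2[OF continuous_on_affine_field cF, of UNIV]) auto
  have c1: "continuous_on (N \<times> UNIV) (\<lambda>x. family (fst x) (snd x) $ 1)"
    by (intro continuous_on_component cF)
  have cM: "continuous_on (N \<times> UNIV) (\<lambda>x. mirror (family (fst x) (snd x)))"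
    by (intro bounded_linear.continuous_on[OF bounded_linear_mirror] cF)
  define V where "V = (\<lambda>s. fL (flow (s * \<tau>) p) $ 1)"
  have "continuous_on UNIV V" unfolding V_def
    by (intro continuous_on_component continuous_on_compose2[OF continuous_on_affine_field, of UNIV]
        continuous_on_compose2[OF continuous_on_flow[of UNIV]] continuous_intros) auto
  then have "isCont V s" for s by (simp add: continuous_on_eq_continuous_at)
  then have cV_at: "(V \<longlongrightarrow> V s) (nhds s)" for s
    by (simp only: isCont_def tendsto_at_iff_tendsto_nhds)
  have "V 0 < 0" "V 1 > 0" using loop by (simp_all add: V_def left_loop_def flow_0)
  then have "\<forall>\<^sub>F s in nhds 0. V s < 0" "\<forall>\<^sub>F s in nhds 1. V s > 0"
    using order_tendstoD[OF cV_at] by blast+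
  then obtain d0 d1 where d0: "d0 > 0" "\<And>s. dist s 0 < d0 \<Longrightarrow> V s < 0"
    and d1: "d1 > 0" "\<And>s. dist s 1 < d1 \<Longrightarrow> V s > 0"
    unfolding eventually_nhds_metric by metis
  define e where "e = min (min (d0 / 2) (d1 / 2)) (1 / 4)"
  have e: "0 < e" "e < 1 / 2" "e < d0" "e < d1" using d0(1) d1(1) by (auto simp: e_def min_def)
  have A1: "\<forall>\<^sub>F t in nhds \<tau>. \<forall>s\<in>{0..e}. fL (family t s) $ 1 \<in> {..<0}"
  proof (rule eventually_compact_slice[OF _ N cV])
    show "fL (family \<tau> s) $ 1 \<in> {..<0}" if "s \<in> {0..e}" for s
      using d0(2)[of s] that e unfolding fam V_def by (simp add: dist_real_def)
  qed auto
  have A2: "\<forall>\<^sub>F t in nhds \<tau>. \<forall>s\<in>{1 - e..1}. fL (family t s) $ 1 \<in> {0<..}"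
  proof (rule eventually_compact_slice[OF _ N cV])
    show "fL (family \<tau> s) $ 1 \<in> {0<..}" if "s \<in> {1 - e..1}" for s
      using d1(2)[of s] that e unfolding fam V_def by (simp add: dist_real_def)
  qed auto
  have A3: "\<forall>\<^sub>F t in nhds \<tau>. \<forall>s\<in>{e..1 - e}. family t s $ 1 \<in> {..<0}"
  proof (rule eventually_compact_slice[OF _ N c1])
    show "family \<tau> s $ 1 \<in> {..<0}" if "s \<in> {e..1 - e}" for s
    proof -
      have "s * \<tau> \<in> {0<..<\<tau>}" using that e \<tau> by auto
      then show ?thesis using loop unfolding fam left_loop_def by blast
    qed
  qed auto
  have sub: "flow (s * \<tau>) p \<in> U" "mirror (flow (s * \<tau>) p) \<in> U" if "s \<in> {0..1}" for s
  proof -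
    have "s * \<tau> \<in> {0..\<tau>}" using that \<tau> by (auto simp: mult_left_le_one_le)
    then show "flow (s * \<tau>) p \<in> U" "mirror (flow (s * \<tau>) p) \<in> U" using U(2) unfolding loop_orbit_def by auto
  qed
  have A4: "\<forall>\<^sub>F t in nhds \<tau>. \<forall>s\<in>{0..1}. family t s \<in> U"
    by (rule eventually_compact_slice[OF _ N cF U(1)]) (use sub fam in auto)
  have A5: "\<forall>\<^sub>F t in nhds \<tau>. \<forall>s\<in>{0..1}. mirror (family t s) \<in> U"
    by (rule eventually_compact_slice[OF _ N cM U(1)]) (use sub fam in auto)
  have A6: "\<forall>\<^sub>F t in nhds \<tau>. t \<in> N \<inter> {0<..}"
    using N \<tau> by (intro eventually_nhds_in_open) auto
  from A1 A2 A3 A4 A5 A6 show ?thesis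
  proof eventually_elim
    case (elim t)
    then have t: "t > 0" "sin (focus_im AL * t) \<noteq> 0" by (auto simp: N_def)
    have "left_loop t (unfocus AL bL (start t))"
      by (rule family_left_loop[OF t e(1,2)]) (use elim in auto)
    moreover have "loop_orbit t (unfocus AL bL (start t)) \<subseteq> U"
    proof -
      have "flow r (unfocus AL bL (start t)) = family t (r / t)" "r / t \<in> {0..1}" if "r \<in> {0..t}" for r
        using t that by (simp_all add: family_eq_flow)
      then show ?thesis using elim(4,5) unfolding loop_orbit_def by auto
    qed
    ultimately show ?case ..
  qed
qed

lemma crossing_motion_left_loop:
  assumes x: "crossing_motion x"
  obtains \<tau> p where "left_loop \<tau> p" "p \<in> range x"
proof -
  obtain t0 where t0: "x t0 $ 1 = 0" "fL (x t0) $ 1 < 0" using crossing_motion_enters_left[OF x] .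
  have "- 1 * fL (x t0) $ 1 > 0" using t0(2) by linarith
  from arc_forward[OF x t0(1) _ this]
  obtain t1 where t1: "t0 < t1" "x t1 $ 1 = 0" "\<And>r. r \<in> {t0<..<t1} \<Longrightarrow> - 1 * x r $ 1 > 0" "- 1 * fL (x t1) $ 1 < 0"
    by metis
  have xf: "x (t0 + r) = flow (0 + r) (x t0)" if "r \<in> {0..t1 - t0}" for r
  proof (rule linear_arc_unique[OF AL_12 FL, where c = bL and l = "t1 - t0"])
    show "(x has_vector_derivative fL (x r)) (at r within {t0..t0 + (t1 - t0)})" if "r \<in> {t0..t0 + (t1 - t0)}" for r
      by (rule left_arc_derivative[OF crossing_motion_solution[OF x]]) (use t1(3) that in auto)
    show "((\<lambda>r. flow r (x t0)) has_vector_derivative fL (flow r (x t0))) (at r within {0..0 + (t1 - t0)})" for r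
      by (rule has_vector_derivative_at_within[OF flow_has_derivative])
  qed (use that in \<open>auto simp: flow_0\<close>)
  have "left_loop (t1 - t0) (x t0)"
    unfolding left_loop_def
  proof (intro conjI ballI)
    show "flow (t1 - t0) (x t0) $ 1 = 0" "fL (flow (t1 - t0) (x t0)) $ 1 > 0"
      using xf[of "t1 - t0"] t1(1,2,4) by auto
    show "flow t (x t0) $ 1 < 0" if "t \<in> {0<..<t1 - t0}" for t
      using xf[of t] t1(3)[of "t0 + t"] that by auto
  qed (use t0 t1(1) in \<open>simp_all del: vector_add_component\<close>)
  then show ?thesis using that by blast
qed

text \<open>If the orbit were isolated, all arcs of nearby durations would start at the same point \<open>p\<close>, and
  the trajectory of \<open>p\<close> would stay on the line for a while; but it crosses with nonzero velocity.\<close>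
lemma no_crossing_limit_cycle: "\<not> crossing_limit_cycle fL fR \<Gamma>"
proof
  assume lc: "crossing_limit_cycle fL fR \<Gamma>"
  then obtain U where U: "open U" "\<Gamma> \<subseteq> U" and iso: "\<And>\<Gamma>'. crossing_periodic_orbit fL fR \<Gamma>' \<Longrightarrow> \<Gamma>' \<subseteq> U \<Longrightarrow> \<Gamma>' = \<Gamma>"
    unfolding crossing_limit_cycle_def by blast
  obtain x where x: "crossing_motion x" "\<Gamma> = range x"
    using lc unfolding crossing_limit_cycle_def crossing_periodic_orbit_iff by blast
  obtain \<tau> p where loop: "left_loop \<tau> p" and p: "p \<in> range x" using crossing_motion_left_loop[OF x(1)] .
  have pin: "p \<in> loop_orbit \<tau> p"
    using loop flow_0[of p] unfolding loop_orbit_def left_loop_def by (metis UnI1 atLeastAtMost_iff image_eqI less_imp_le order_refl)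
  obtain y where y: "crossing_motion y" "loop_orbit \<tau> p = range y"
    using loop_orbit_crossing_periodic[OF loop] unfolding crossing_periodic_orbit_iff by blast
  have "loop_orbit \<tau> p = \<Gamma>"
    using crossing_orbits_meeting_eq[OF x(1) y(1)] p pin unfolding y(2) x(2) by (metis imageE)
  then have "\<forall>\<^sub>F t in nhds \<tau>. left_loop t (unfocus AL bL (start t)) \<and> loop_orbit t (unfocus AL bL (start t)) \<subseteq> U"
    using eventually_nearby_loop[OF loop U(1)] U(2) by simp
  then obtain d where d: "d > 0" "\<And>t. dist t \<tau> < d \<Longrightarrow>
      left_loop t (unfocus AL bL (start t)) \<and> loop_orbit t (unfocus AL bL (start t)) \<subseteq> U"
    unfolding eventually_nhds_metric by blast
  have back_on_line: "flow t p $ 1 = 0" if "dist t \<tau> < d" for t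
  proof -
    note l = d(2)[OF that, THEN conjunct1] and s = d(2)[OF that, THEN conjunct2]
    have "loop_orbit t (unfocus AL bL (start t)) = \<Gamma>" using iso loop_orbit_crossing_periodic[OF l] s by blast
    then have "p = unfocus AL bL (start t)"
      using loop_orbit_start_unique[OF l, of p] p x(2) loop unfolding left_loop_def by blast
    then show ?thesis using l unfolding left_loop_def by simp
  qed
  have "((\<lambda>r. flow r p $ 1) has_real_derivative fL (flow \<tau> p) $ 1) (at \<tau>)"
    using bounded_linear.has_vector_derivative[OF bounded_linear_vec_nth flow_has_derivative]
    by (simp add: has_real_derivative_iff_has_vector_derivative)
  moreover have "fL (flow \<tau> p) $ 1 > 0" using loop by (simp only: left_loop_def)
  ultimately obtain h where h: "h > 0" "\<And>k. 0 < k \<Longrightarrow> k < h \<Longrightarrow> flow \<tau> p $ 1 < flow (\<tau> + k) p $ 1"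
    using DERIV_pos_inc_right by blast
  define k where "k = min h d / 2"
  have "0 < k" "k < h" "k < d" using h(1) d(1) by (auto simp: k_def min_def)
  then show False using h(2)[of k] back_on_line[of \<tau>] back_on_line[of "\<tau> + k"] d(1) by (simp add: dist_real_def)
qed

end

section \<open>At most one limit cycle\<close>

theorem theorem7:
  fixes AL AR :: "real^2^2" and bL bR :: "real^2"
    and TL TR DL DR aL aR b :: real
  assumes "AL $ 1 $ 2 * AR $ 1 $ 2 > 0"
    and "TL = trace AL" and "TR = trace AR" and "DL = det AL" and "DR = det AR"
    and "aL = AL $ 1 $ 2 * bL $ 2 - AL $ 2 $ 2 * bL $ 1"
    and "aR = AL $ 1 $ 2 / AR $ 1 $ 2 * (AR $ 1 $ 2 * bR $ 2 - AR $ 2 $ 2 * bR $ 1)"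
    and "b = AL $ 1 $ 2 * bR $ 1 / AR $ 1 $ 2 - bL $ 1"
    and "TL^2 - 4 * DL < 0" and "TR^2 - 4 * DR < 0"
    and "Delta TL TR DL DR aL aR b < 0 \<or>
         (Delta TL TR DL DR aL aR b = 0 \<and>
          b = (aL * DR * TL - aR * DL * TR) / (2 * DL * DR) \<and> aL * aR < 0)"
  shows "\<exists>\<^sub>\<le>\<^sub>1 \<Gamma>. crossing_limit_cycle (\<lambda>x. AL *v x + bL) (\<lambda>x. AR *v x + bR) \<Gamma>"
proof -
  interpret two_foci AL AR bL bR
    by unfold_locales (use assms in auto)
  have aL_eq: "aL = forcing AL bL" and aR_eq: "aR = ratio * forcing AR bR" and b_eq: "b = offset"
    using assms(6-8) by (simp_all add: forcing_def ratio_def offset_def)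
  have D: "DL > 0" "DR > 0" using det_pos_of_focus FL FR assms(4,5) by auto
  have nz: "aL \<noteq> 0" "aR \<noteq> 0" using assms(11) by (auto simp: Delta_def not_less)
  interpret two_forced_foci AL AR bL bR
    by unfold_locales (use nz aL_eq aR_eq in auto)
  show ?thesis
  proof (cases "b = 0")
    case False
    have "Delta (trace AL) (trace AR) (det AL) (det AR) (forcing AL bL) (ratio * forcing AR bR) offset \<le> 0"
      using assms(11) unfolding aL_eq aR_eq b_eq assms(2-5) by auto
    moreover have "offset \<noteq> 0" using False b_eq by simp
    ultimately show ?thesis
      using crossing_periodic_orbits_eq unfolding Uniq_def crossing_limit_cycle_def by blast
  next
    case True
    have sq: "Delta TL TR DL DR aL aR 0 = (DR * aL\<^sup>2 - DL * aR\<^sup>2)\<^sup>2"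
      unfolding Delta_def by (simp add: power2_eq_square algebra_simps)
    then have "\<not> Delta TL TR DL DR aL aR b < 0" using True by simp
    then have h: "DR * aL\<^sup>2 - DL * aR\<^sup>2 = 0" "aL * DR * TL - aR * DL * TR = 0" "aL * aR < 0"
      using assms(11) True sq D by auto
    \<comment> \<open>The time scale of the mirror symmetry, read off from \<open>a\<^sub>R = - m a\<^sub>L\<close>.\<close>
  define m where "m = - aR / aL"
    have m: "m > 0" "aR = - m * aL" using h(3) nz by (auto simp: m_def mult_less_0_iff divide_less_0_iff zero_less_divide_iff)
    have "(DR - m\<^sup>2 * DL) * aL\<^sup>2 = 0" using h(1) unfolding m(2) by (simp add: algebra_simps power_mult_distrib)
    then have DR: "DR = m\<^sup>2 * DL" using nz by simp
    have "aL * DL * m * (m * TL + TR) = 0" using h(2) unfolding m(2) DR by (simp add: algebra_simps power2_eq_square)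
    then have TR: "TR = - m * TL" using nz D m by simp
    interpret mirrored_foci AL AR bL bR m
      by unfold_locales (use m DR TR True aL_eq aR_eq b_eq assms(2-5) in auto)
    show ?thesis using no_crossing_limit_cycle unfolding Uniq_def by blast
  qed
qed

end
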